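(* Let $n\ge 2$ be an integer and let $D_n$ be the dihedral group of order $2n$. Then the co-maximal hypergraph $Co_{\mathcal{H}}(D_n)$ is connected with $\operatorname{diam}(Co_{\mathcal{H}}(D_n))\le 3$. In particular, $$\operatorname{diam}(Co_{\mathcal{H}}(D_n))=\begin{cases}1 & \text{if } n=2,\\ 2 & \text{if } n=p^{\alpha} \text{ where } p \text{ is a prime, } \alpha\ge 1 \text{ and } n\ne 2,\\ 3 & \text{otherwise.}\end{cases}$$
   Context: For $n\ge 1$, $D_n=\langle a,b \mid a^n=e,\ b^2=e,\ bab^{-1}=a^{-1}\rangle$ is the dihedral group of order $2n$ (so $D_2$ is the Klein four-group). For a group $G$, let $S$ be the set of all non-trivial proper subgroups of $G$ (i.e. subgroups different from $\{e\}$ and $G$). For subgroups $H,K$, $HK=\{hk : h\in H, k\in K\}$. The co-maximal hypergraph $Co_{\mathcal{H}}(G)$ has vertex set $V=\{H\in S : HK=G \text{ for some } K\in S\}$, and a subset $E\subseteq V$ is a hyperedge if and only if (1) $HK=G$ for all distinct $H,K\in E$, and (2) no subset $E'\subseteq V$ properly containing $E$ satisfies (1). A path in a hypergraph is an alternating sequence $v_1e_1v_2e_2\ldots v_k$ of distinct vertices and distinct hyperedges such that $v_i,v_{i+1}\in e_i$ for all $1\le i\le k-1$; its length is the number of hyperedges in it. A hypergraph is connected if there is a path between any two vertices. The distance between two vertices is the minimum length of a path connecting them, and the diameter $\operatorname{diam}$ is the maximum distance over all pairs of vertices. *)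

theory Defs
  imports
    "HOL-Algebra.Coset"
    "HOL-Library.Extended_Nat"
    "HOL-Computational_Algebra.Primes"
begin

text \<open>
  A letter \<open>(x, True)\<close> stands for the generator \<open>x\<close>, and \<open>(x, False)\<close> for its formal inverse.
\<close>

type_synonym 'g word = "('g \<times> bool) list"

text \<open>
  The least congruence on words that contains the free cancellations and the relations \<open>R\<close>;
  a pair \<open>(l, r) \<in> R\<close> stands for the relation \<open>l = r\<close>.
\<close>

inductive word_eq :: "('g word \<times> 'g word) set \<Rightarrow> 'g word \<Rightarrow> 'g word \<Rightarrow> bool" for R where
  refl: "word_eq R u u"
| sym: "word_eq R u v \<Longrightarrow> word_eq R v u"
| trans: "word_eq R u v \<Longrightarrow> word_eq R v w \<Longrightarrow> word_eq R u w"
| cancel: "word_eq R (u @ [(x, s), (x, \<not> s)] @ v) (u @ v)"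
| relation: "(l, r) \<in> R \<Longrightarrow> word_eq R (u @ l @ v) (u @ r @ v)"

definition word_class :: "('g word \<times> 'g word) set \<Rightarrow> 'g word \<Rightarrow> 'g word set" where
  "word_class R u = {v. word_eq R u v}"

text \<open>The group \<open>\<langle>UNIV | R\<rangle>\<close>: every element of the type \<open>'g\<close> is a generator.\<close>

definition presented_group :: "('g word \<times> 'g word) set \<Rightarrow> 'g word set monoid" where
  "presented_group R =
     \<lparr>carrier = range (word_class R),
      monoid.mult = (\<lambda>A B. \<Union>u\<in>A. \<Union>v\<in>B. word_class R (u @ v)),
      one = word_class R []\<rparr>"

lemma word_eq_append_left: "word_eq R u v \<Longrightarrow> word_eq R (w @ u) (w @ v)"
proof (induction rule: word_eq.induct)
  case (cancel u x s v)
  show ?case using word_eq.cancel[of R "w @ u" x s v] by simp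
next
  case (relation l r u v)
  then show ?case using word_eq.relation[of l r R "w @ u" v] by simp
qed (rule word_eq.refl, erule word_eq.sym, erule (1) word_eq.trans)

lemma word_eq_append_right: "word_eq R u v \<Longrightarrow> word_eq R (u @ w) (v @ w)"
proof (induction rule: word_eq.induct)
  case (cancel u x s v)
  show ?case using word_eq.cancel[of R u x s "v @ w"] by simp
next
  case (relation l r u v)
  then show ?case using word_eq.relation[of l r R u "v @ w"] by simp
qed (rule word_eq.refl, erule word_eq.sym, erule (1) word_eq.trans)

lemma word_eq_append:
  "word_eq R u u' \<Longrightarrow> word_eq R v v' \<Longrightarrow> word_eq R (u @ v) (u' @ v')"
  by (meson word_eq_append_left word_eq_append_right word_eq.trans)

lemma word_class_eq_iff: "word_class R u = word_class R v \<longleftrightarrow> word_eq R u v"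
  unfolding word_class_def set_eq_iff mem_Collect_eq
  by (meson word_eq.refl word_eq.sym word_eq.trans)

lemma carrier_presented_group: "carrier (presented_group R) = range (word_class R)"
  by (simp add: presented_group_def)

lemma one_presented_group: "\<one>\<^bsub>presented_group R\<^esub> = word_class R []"
  by (simp add: presented_group_def)

lemma mult_presented_group:
  "word_class R u \<otimes>\<^bsub>presented_group R\<^esub> word_class R v = word_class R (u @ v)"
proof -
  have "word_class R (u' @ v') = word_class R (u @ v)"
    if "u' \<in> word_class R u" "v' \<in> word_class R v" for u' v'
    unfolding word_class_eq_iff
    using that by (simp add: word_class_def word_eq.sym word_eq_append)
  moreover have "u \<in> word_class R u" "v \<in> word_class R v"
    by (simp_all add: word_class_def word_eq.refl)
  ultimately have "(\<Union>u'\<in>word_class R u. \<Union>v'\<in>word_class R v. word_class R (u' @ v'))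
      = word_class R (u @ v)"
    by blast
  then show ?thesis by (simp add: presented_group_def)
qed

lemma word_eq_inverse: "word_eq R (rev (map (\<lambda>(x, s). (x, \<not> s)) u) @ u) []"
proof (induction u)
  case Nil
  show ?case by (auto intro: word_eq.refl)
next
  case (Cons y u)
  obtain x s where y: "y = (x, s)" by force
  show ?case
    using word_eq.trans[OF word_eq.cancel[of R "rev (map (\<lambda>(x, s). (x, \<not> s)) u)" x "\<not> s" u] Cons]
    by (simp add: y)
qed

lemma group_presented_group: "group (presented_group R)"
proof (rule groupI)
  fix x assume "x \<in> carrier (presented_group R)"
  then obtain u where x: "x = word_class R u" by (auto simp: carrier_presented_group)
  let ?y = "word_class R (rev (map (\<lambda>(x, s). (x, \<not> s)) u))"
  have "?y \<otimes>\<^bsub>presented_group R\<^esub> x = \<one>\<^bsub>presented_group R\<^esub>"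
    by (simp add: x one_presented_group mult_presented_group word_class_eq_iff word_eq_inverse)
  moreover have "?y \<in> carrier (presented_group R)" by (simp add: carrier_presented_group)
  ultimately show "\<exists>y\<in>carrier (presented_group R). y \<otimes>\<^bsub>presented_group R\<^esub> x = \<one>\<^bsub>presented_group R\<^esub>"
    by blast
qed (auto simp: carrier_presented_group one_presented_group mult_presented_group)

datatype dihedral_gen = Gen_a | Gen_b

abbreviation dihedral_relations :: "nat \<Rightarrow> (dihedral_gen word \<times> dihedral_gen word) set" where
  "dihedral_relations n \<equiv>
     {(replicate n (Gen_a, True), []),
      (replicate 2 (Gen_b, True), []),
      ([(Gen_b, True), (Gen_a, True), (Gen_b, False)], [(Gen_a, False)])}"

definition dihedral_group :: "nat \<Rightarrow> dihedral_gen word set monoid" where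
  "dihedral_group n = presented_group (dihedral_relations n)"

lemma group_dihedral_group: "group (dihedral_group n)"
  by (simp add: dihedral_group_def group_presented_group)

text \<open>
  Left multiplication of \<open>a\<^sup>i b\<^sup>j\<close>, encoded as \<open>(i, odd j)\<close> with \<open>0 \<le> i < n\<close>, by a letter;
  it serves to show that the presented group has exactly \<open>2 n\<close> elements.
\<close>

fun letter_act :: "nat \<Rightarrow> dihedral_gen \<times> bool \<Rightarrow> int \<times> bool \<Rightarrow> int \<times> bool" where
  "letter_act n (Gen_a, s) (i, t) = ((if s then i + 1 else i - 1) mod int n, t)"
| "letter_act n (Gen_b, s) (i, t) = ((- i) mod int n, \<not> t)"

definition word_act :: "nat \<Rightarrow> dihedral_gen word \<Rightarrow> int \<times> bool \<Rightarrow> int \<times> bool" where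
  "word_act n u = foldr (letter_act n) u"

lemma word_act_Nil [simp]: "word_act n [] x = x"
  and word_act_Cons [simp]: "word_act n (y # u) x = letter_act n y (word_act n u x)"
  and word_act_append [simp]: "word_act n (u @ v) x = word_act n u (word_act n v x)"
  by (simp_all add: word_act_def)

lemma word_act_range:
  assumes "n > 0" "fst x \<in> {0..<int n}"
  shows "fst (word_act n u x) \<in> {0..<int n}"
proof (induction u)
  case (Cons y u)
  then show ?case
    using assms(1) by (cases "(n, y, word_act n u x)" rule: letter_act.cases) auto
qed (use assms in auto)

lemma word_act_replicate_a:
  assumes "0 \<le> i" "i < int n"
  shows "word_act n (replicate k (Gen_a, True)) (i, t) = ((i + int k) mod int n, t)"
  using assms by (induction k) (auto simp: mod_simps ac_simps)

lemma word_act_cong: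
  assumes "word_eq (dihedral_relations n) u v" "n > 0" "fst x \<in> {0..<int n}"
  shows "word_act n u x = word_act n v x"
  using assms
proof (induction arbitrary: x rule: word_eq.induct)
  case (cancel u y s v)
  obtain i t where it: "word_act n v x = (i, t)" by force
  with word_act_range[OF cancel, of v] have "0 \<le> i" "i < int n" by auto
  then show ?case by (cases y) (auto simp: it mod_simps)
next
  case (relation l r u v)
  obtain i t where it: "word_act n v x = (i, t)" by force
  with word_act_range[OF relation(2,3), of v] have i: "0 \<le> i" "i < int n" by auto
  then have "word_act n l (i, t) = word_act n r (i, t)"
    using relation(1) word_act_replicate_a[OF i, of n t]
    by (auto simp: numeral_2_eq_2 mod_simps)
  then show ?case by (simp add: it)
qed auto

lemma order_dihedral_group:
  assumes "n > 0"
  shows "order (dihedral_group n) = 2 * n"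
proof -
  define G where "G = dihedral_group n"
  interpret group G
    unfolding G_def by (rule group_dihedral_group)
  define cl where "cl = word_class (dihedral_relations n)"
  have carrier_G: "carrier G = range cl"
    by (simp add: G_def cl_def dihedral_group_def carrier_presented_group)
  have one_G: "\<one>\<^bsub>G\<^esub> = cl []"
    by (simp add: G_def cl_def dihedral_group_def one_presented_group)
  have mult_G: "cl u \<otimes>\<^bsub>G\<^esub> cl v = cl (u @ v)" for u v
    by (simp add: G_def cl_def dihedral_group_def mult_presented_group)
  have cl_carrier [simp]: "cl u \<in> carrier G" for u
    by (simp add: carrier_G)
  have cl_rel: "cl l = cl r" if "(l, r) \<in> dihedral_relations n" for l r
    using word_eq.relation[OF that, of "[]" "[]"] by (simp add: cl_def word_class_eq_iff)
  have cl_cancel: "cl [(x, s), (x, \<not> s)] = \<one>\<^bsub>G\<^esub>" for x s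
    using word_eq.cancel[of "dihedral_relations n" "[]" x s "[]"]
    by (simp add: one_G cl_def word_class_eq_iff)
  have cl_pow: "cl (replicate k (x, True)) = cl [(x, True)] [^]\<^bsub>G\<^esub> k" for k x
  proof (induction k)
    case (Suc k)
    have "cl (replicate (Suc k) (x, True)) = cl (replicate k (x, True)) \<otimes>\<^bsub>G\<^esub> cl [(x, True)]"
      by (simp add: mult_G replicate_append_same)
    with Suc show ?case by simp
  qed (simp add: one_G)
  define a where "a = cl [(Gen_a, True)]"
  define b where "b = cl [(Gen_b, True)]"
  have ab [simp]: "a \<in> carrier G" "b \<in> carrier G"
    by (simp_all add: a_def b_def)
  have cl_inv: "cl [(x, False)] = inv\<^bsub>G\<^esub> cl [(x, True)]" for x
    using cl_cancel[of x False] by (intro inv_equality[symmetric]) (simp_all add: mult_G)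
  have an: "a [^]\<^bsub>G\<^esub> n = \<one>\<^bsub>G\<^esub>"
    using cl_rel[of "replicate n (Gen_a, True)" "[]"] by (simp add: a_def one_G flip: cl_pow)
  have bb: "b \<otimes>\<^bsub>G\<^esub> b = \<one>\<^bsub>G\<^esub>"
    using cl_rel[of "replicate 2 (Gen_b, True)" "[]"]
    by (simp add: b_def one_G mult_G numeral_2_eq_2)
  have invb: "inv\<^bsub>G\<^esub> b = b"
    by (rule inv_equality) (simp_all add: bb)
  have "b \<otimes>\<^bsub>G\<^esub> a \<otimes>\<^bsub>G\<^esub> inv\<^bsub>G\<^esub> b = inv\<^bsub>G\<^esub> a"
    using cl_rel[of "[(Gen_b, True), (Gen_a, True), (Gen_b, False)]" "[(Gen_a, False)]"]
    by (simp add: a_def b_def mult_G flip: cl_inv)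
  then have "b \<otimes>\<^bsub>G\<^esub> a \<otimes>\<^bsub>G\<^esub> b \<otimes>\<^bsub>G\<^esub> b = inv\<^bsub>G\<^esub> a \<otimes>\<^bsub>G\<^esub> b"
    by (simp add: invb)
  then have ba: "b \<otimes>\<^bsub>G\<^esub> a = inv\<^bsub>G\<^esub> a \<otimes>\<^bsub>G\<^esub> b"
    by (simp add: m_assoc bb)
  define nf where "nf = (\<lambda>(i :: nat, t). a [^]\<^bsub>G\<^esub> i \<otimes>\<^bsub>G\<^esub> (if t then b else \<one>\<^bsub>G\<^esub>))"
  have inva: "inv\<^bsub>G\<^esub> a = a [^]\<^bsub>G\<^esub> (n - 1)"
  proof (rule inv_equality)
    show "a [^]\<^bsub>G\<^esub> (n - 1) \<otimes>\<^bsub>G\<^esub> a = \<one>\<^bsub>G\<^esub>"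
      using an assms nat_pow_Suc[of a "n - 1"] by simp
  qed simp_all
  have nf_a: "a [^]\<^bsub>G\<^esub> k \<otimes>\<^bsub>G\<^esub> nf (i, t) = nf (k + i, t)" for i k :: nat and t
    by (simp add: nf_def nat_pow_mult flip: m_assoc)
  have nf_b: "b \<otimes>\<^bsub>G\<^esub> nf (i, t) = nf ((n - 1) * i, \<not> t)" for i t
  proof -
    have "b \<otimes>\<^bsub>G\<^esub> a [^]\<^bsub>G\<^esub> i = a [^]\<^bsub>G\<^esub> ((n - 1) * i) \<otimes>\<^bsub>G\<^esub> b"
    proof (induction i)
      case (Suc i)
      have "b \<otimes>\<^bsub>G\<^esub> a [^]\<^bsub>G\<^esub> Suc i = b \<otimes>\<^bsub>G\<^esub> a [^]\<^bsub>G\<^esub> i \<otimes>\<^bsub>G\<^esub> a"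
        by (simp add: m_assoc)
      also have "\<dots> = a [^]\<^bsub>G\<^esub> ((n - 1) * i) \<otimes>\<^bsub>G\<^esub> (b \<otimes>\<^bsub>G\<^esub> a)"
        unfolding Suc by (simp add: m_assoc)
      also have "\<dots> = a [^]\<^bsub>G\<^esub> ((n - 1) * i) \<otimes>\<^bsub>G\<^esub> a [^]\<^bsub>G\<^esub> (n - 1) \<otimes>\<^bsub>G\<^esub> b"
        by (simp add: ba inva m_assoc)
      finally show ?case by (simp add: nat_pow_mult add.commute)
    qed simp
    then have "b \<otimes>\<^bsub>G\<^esub> nf (i, t)
        = a [^]\<^bsub>G\<^esub> ((n - 1) * i) \<otimes>\<^bsub>G\<^esub> b \<otimes>\<^bsub>G\<^esub> (if t then b else \<one>\<^bsub>G\<^esub>)"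
      by (simp add: nf_def flip: m_assoc)
    then show ?thesis
      by (cases t) (simp_all add: nf_def m_assoc bb)
  qed
  have letter: "\<exists>y. cl [z] \<otimes>\<^bsub>G\<^esub> nf x = nf y" for z x
  proof -
    obtain i t where x: "x = (i, t)" by force
    obtain g s where "z = (g, s)" by force
    then consider "z = (Gen_a, True)" | "z = (Gen_a, False)" | "z = (Gen_b, True)" | "z = (Gen_b, False)"
      by (cases g; cases s) simp_all
    then show ?thesis
    proof cases
      case 1
      then have "cl [z] = a [^]\<^bsub>G\<^esub> (1 :: nat)" by (simp add: a_def)
      then have "cl [z] \<otimes>\<^bsub>G\<^esub> nf x = nf (1 + i, t)" unfolding x by (simp only: nf_a)
      then show ?thesis by blast
    next
      case 2
      then have "cl [z] = a [^]\<^bsub>G\<^esub> (n - 1)" by (simp add: cl_inv inva flip: a_def)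
      then have "cl [z] \<otimes>\<^bsub>G\<^esub> nf x = nf (n - 1 + i, t)" unfolding x by (simp only: nf_a)
      then show ?thesis by blast
    next
      case 3
      then have "cl [z] = b" by (simp add: b_def)
      then have "cl [z] \<otimes>\<^bsub>G\<^esub> nf x = nf ((n - 1) * i, \<not> t)" unfolding x by (simp only: nf_b)
      then show ?thesis by blast
    next
      case 4
      then have "cl [z] = b" by (simp add: cl_inv invb flip: b_def)
      then have "cl [z] \<otimes>\<^bsub>G\<^esub> nf x = nf ((n - 1) * i, \<not> t)" unfolding x by (simp only: nf_b)
      then show ?thesis by blast
    qed
  qed
  have nf_ex: "\<exists>x. cl u = nf x" for u
  proof (induction u)
    case Nil
    have "cl [] = nf (0, False)" by (simp add: nf_def one_G)
    then show ?case by blast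
  next
    case (Cons z u)
    have "cl (z # u) = cl [z] \<otimes>\<^bsub>G\<^esub> cl u" by (simp add: mult_G)
    with Cons letter show ?case by metis
  qed
  have nf_mod: "nf (i, t) = nf (i mod n, t)" for i t
  proof -
    have "a [^]\<^bsub>G\<^esub> i = a [^]\<^bsub>G\<^esub> (n * (i div n)) \<otimes>\<^bsub>G\<^esub> a [^]\<^bsub>G\<^esub> (i mod n)"
      by (simp add: nat_pow_mult)
    also have "a [^]\<^bsub>G\<^esub> (n * (i div n)) = \<one>\<^bsub>G\<^esub>"
      by (simp add: an flip: nat_pow_pow)
    finally show ?thesis by (simp add: nf_def)
  qed
  let ?N = "{..<n} \<times> (UNIV :: bool set)"
  have "carrier G \<subseteq> nf ` ?N"
  proof
    fix g assume "g \<in> carrier G"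
    then obtain i t where "g = nf (i, t)"
      using nf_ex unfolding carrier_G by (metis imageE prod.collapse)
    then have "g = nf (i mod n, t)" using nf_mod by simp
    then show "g \<in> nf ` ?N" using assms by auto
  qed
  moreover have "nf ` ?N \<subseteq> carrier G"
    by (auto simp: nf_def)
  moreover have "inj_on nf ?N"
  proof (rule inj_onI)
    fix x y assume xy: "x \<in> ?N" "y \<in> ?N" "nf x = nf y"
    define w where "w = (\<lambda>(i, t). replicate i (Gen_a, True) @ (if t then [(Gen_b, True)] else []))"
    have w: "nf (i, t) = cl (w (i, t))" for i t
      by (simp add: w_def nf_def a_def b_def one_G flip: cl_pow mult_G)
    have act: "word_act n (w (i, t)) (0, False) = (int i, t)" if "i < n" for i t
      using that by (cases t) (simp_all add: w_def word_act_replicate_a)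
    have "cl (w x) = cl (w y)" using xy(3) w by (cases x, cases y) simp
    then have "word_act n (w x) (0, False) = word_act n (w y) (0, False)"
      unfolding cl_def word_class_eq_iff by (rule word_act_cong) (simp_all add: assms)
    then show "x = y" using xy(1,2) act by (cases x, cases y) auto
  qed
  ultimately have "card (carrier G) = card ?N"
    by (metis card_image subset_antisym)
  then show ?thesis by (simp add: order_def G_def card_cartesian_product)
qed

record 'v hypergraph =
  hverts :: "'v set"
  hedges :: "'v set set"

definition hpath :: "'v hypergraph \<Rightarrow> 'v list \<Rightarrow> 'v set list \<Rightarrow> bool" where
  "hpath X vs es \<longleftrightarrow>
     length vs = Suc (length es) \<and>
     set vs \<subseteq> hverts X \<and> set es \<subseteq> hedges X \<and>
     distinct vs \<and> distinct es \<and>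
     (\<forall>i<length es. vs ! i \<in> es ! i \<and> vs ! Suc i \<in> es ! i)"

definition hpath_between :: "'v hypergraph \<Rightarrow> 'v \<Rightarrow> 'v list \<Rightarrow> 'v set list \<Rightarrow> 'v \<Rightarrow> bool" where
  "hpath_between X u vs es v \<longleftrightarrow> hpath X vs es \<and> hd vs = u \<and> last vs = v"

definition hconnected :: "'v hypergraph \<Rightarrow> bool" where
  "hconnected X \<longleftrightarrow> (\<forall>u\<in>hverts X. \<forall>v\<in>hverts X. \<exists>vs es. hpath_between X u vs es v)"

text \<open>Distance and diameter are \<open>\<infinity>\<close> where there is no path, or no maximal distance.\<close>

definition hdist :: "'v hypergraph \<Rightarrow> 'v \<Rightarrow> 'v \<Rightarrow> enat" where
  "hdist X u v = Inf {enat (length es) | vs es. hpath_between X u vs es v}"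

definition hdiam :: "'v hypergraph \<Rightarrow> enat" where
  "hdiam X = (SUP u\<in>hverts X. SUP v\<in>hverts X. hdist X u v)"

definition nontrivial_proper_subgroups :: "('a, 'b) monoid_scheme \<Rightarrow> 'a set set" where
  "nontrivial_proper_subgroups G = {H. subgroup H G \<and> H \<noteq> {\<one>\<^bsub>G\<^esub>} \<and> H \<noteq> carrier G}"

definition comaximal :: "('a, 'b) monoid_scheme \<Rightarrow> 'a set \<Rightarrow> 'a set \<Rightarrow> bool" where
  "comaximal G H K \<longleftrightarrow> H <#>\<^bsub>G\<^esub> K = carrier G"

definition comaximal_verts :: "('a, 'b) monoid_scheme \<Rightarrow> 'a set set" where
  "comaximal_verts G =
     {H \<in> nontrivial_proper_subgroups G. \<exists>K\<in>nontrivial_proper_subgroups G. comaximal G H K}"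

definition comaximal_hypergraph :: "('a, 'b) monoid_scheme \<Rightarrow> 'a set hypergraph" where
  "comaximal_hypergraph G =
     \<lparr>hverts = comaximal_verts G,
      hedges = {E. E \<subseteq> comaximal_verts G \<and> pairwise (comaximal G) E \<and>
                   \<not> (\<exists>E'\<subseteq>comaximal_verts G. E \<subset> E' \<and> pairwise (comaximal G) E')}\<rparr>"

end

theory Submission
  imports Defs "HOL-Algebra.Generated_Groups"
begin

text \<open>
  Any two comaximal vertices lie in a common hyperedge, so distances in the hypergraph are distances
  in the comaximality graph. In \<open>D\<^sub>n\<close> the rotation subgroup \<open>\<langle>a\<rangle>\<close> has index 2, hence it is comaximal
  with every subgroup containing a reflection, while two subgroups of rotations are never comaximal.
  A subgroup of rotations is a vertex iff it is comaximal with \<open>\<langle>a\<^sup>q, b\<rangle>\<close> for some prime \<open>q\<close> dividing \<open>n\<close>,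
  and these subgroups are comaximal with each other (for distinct primes) and with \<open>\<langle>a\<rangle>\<close>; this gives paths of length at
  most 3. If \<open>n = p\<^sup>k m\<close> with \<open>k > 0\<close>, \<open>m > 1\<close> and \<open>p\<close> not dividing \<open>m\<close>, then \<open>\<langle>a\<^sup>d\<rangle>\<close> for \<open>d = p\<^sup>k\<close> and \<open>\<langle>a\<^sup>m\<rangle>\<close>
  have no common neighbour. If \<open>n\<close> is a prime power, \<open>\<langle>a\<rangle>\<close> is the only vertex consisting of rotations,
  and for \<open>n > 2\<close> the vertices \<open>{1, b}\<close> and \<open>{1, a b}\<close> are not comaximal.
\<close>

section \<open>Paths, distances and diameters in an arbitrary hypergraph\<close>

lemma hpath_take:
  assumes "hpath X vs es" "i \<le> length es"
  shows "hpath X (take (Suc i) vs) (take i es)"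
  using assms set_take_subset[of "Suc i" vs] set_take_subset[of i es]
  unfolding hpath_def by (auto simp: min_def)

lemma hpath_between_take:
  assumes "hpath_between X u vs es w" "i \<le> length es"
  shows "hpath_between X u (take (Suc i) vs) (take i es) (vs ! i)"
proof -
  have "length vs = Suc (length es)" "hd vs = u" "vs \<noteq> []"
    using assms(1) by (auto simp: hpath_between_def hpath_def)
  then show ?thesis
    using assms hpath_take[of X vs es i]
    by (auto simp: hpath_between_def take_Suc_conv_app_nth hd_append hd_conv_nth)
qed

text \<open>
  The path is cut at the first vertex that shares a hyperedge with the new endpoint, so that
  vertices and hyperedges stay distinct.
\<close>

lemma hpath_between_extend:
  assumes path: "hpath_between X u vs es w"
    and e: "e \<in> hedges X" "w \<in> e" "v \<in> e" and v: "v \<in> hverts X"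
  shows "\<exists>vs' es'. hpath_between X u vs' es' v \<and> length es' \<le> Suc (length es)"
proof (cases "v \<in> set vs")
  case True
  then obtain j where "j < length vs" "v = vs ! j" by (auto simp: in_set_conv_nth)
  moreover have "length vs = Suc (length es)"
    using path by (simp add: hpath_between_def hpath_def)
  ultimately show ?thesis
    using hpath_between_take[OF path, of j]
    by (intro exI[of _ "take (Suc j) vs"] exI[of _ "take j es"]) auto
next
  case False
  have len: "length vs = Suc (length es)"
    using path by (simp add: hpath_between_def hpath_def)
  define P where "P i \<longleftrightarrow> i \<le> length es \<and> (\<exists>f\<in>hedges X. vs ! i \<in> f \<and> v \<in> f)" for i
  have "vs ! length es = w"
    using path len by (metis diff_Suc_1 hpath_between_def last_conv_nth length_0_conv nat.distinct(1))
  then have "P (length es)" using e by (auto simp: P_def)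
  then have Pi: "P (Least P)" by (rule LeastI)
  define i where "i = Least P"
  obtain f where f: "i \<le> length es" "f \<in> hedges X" "vs ! i \<in> f" "v \<in> f"
    using Pi by (auto simp: P_def i_def)
  define ws fs where "ws = take (Suc i) vs" and "fs = take i es"
  have ws: "hpath_between X u ws fs (vs ! i)"
    unfolding ws_def fs_def using path f(1) by (rule hpath_between_take)
  have lens: "length ws = Suc i" "length fs = i"
    using f(1) len by (simp_all add: ws_def fs_def)
  have "f \<notin> set fs"
  proof
    assume "f \<in> set fs"
    then obtain j where j: "j < i" "f = es ! j"
      using lens by (auto simp: in_set_conv_nth fs_def)
    then have "vs ! j \<in> f"
      using path f(1) by (auto simp: hpath_between_def hpath_def)
    then have "P j" using j f by (auto simp: P_def)
    with j not_less_Least[of j P] show False by (simp add: i_def)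
  qed
  moreover have "v \<notin> set ws"
    using False by (auto simp: ws_def dest: in_set_takeD)
  moreover have "ws ! i = vs ! i" by (simp add: ws_def)
  ultimately have "hpath_between X u (ws @ [v]) (fs @ [f]) v"
    using ws f v lens by (auto simp: hpath_between_def hpath_def nth_append less_Suc_eq hd_append)
  then show ?thesis
    using lens f(1) by (intro exI[of _ "ws @ [v]"] exI[of _ "fs @ [f]"]) simp
qed

text \<open>A nonempty infimum in \<open>enat\<close> is attained and the empty one is infinite, so
  a finite bound yields an actual path. All later distance statements have the form
  \<open>\<le> enat k\<close> and go through this characterisation.\<close>

lemma hdist_le_iff:
  "hdist X u v \<le> enat k \<longleftrightarrow> (\<exists>vs es. hpath_between X u vs es v \<and> length es \<le> k)"
proof
  define A where "A = {enat (length es) | vs es. hpath_between X u vs es v}"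
  assume le: "hdist X u v \<le> enat k"
  then have le_A: "Inf A \<le> enat k" by (simp add: hdist_def A_def)
  then have "A \<noteq> {}" by (auto simp: Inf_enat_def)
  then obtain x where "x \<in> A" by blast
  then have "Inf A \<in> A"
    using LeastI[of "\<lambda>x. x \<in> A" x] \<open>A \<noteq> {}\<close> by (simp add: Inf_enat_def)
  then obtain vs es where "Inf A = enat (length es)" "hpath_between X u vs es v"
    unfolding A_def by blast
  with le_A show "\<exists>vs es. hpath_between X u vs es v \<and> length es \<le> k"
    by (intro exI[of _ vs] exI[of _ es]) simp
next
  assume "\<exists>vs es. hpath_between X u vs es v \<and> length es \<le> k"
  then obtain vs es where *: "hpath_between X u vs es v" "length es \<le> k" by blast
  then have "hdist X u v \<le> enat (length es)"
    unfolding hdist_def by (intro Inf_lower) blast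
  with *(2) show "hdist X u v \<le> enat k"
    by (meson enat_ord_simps(1) order_trans)
qed

lemma hpath_between_verts:
  assumes "hpath_between X u vs es v"
  shows "u \<in> hverts X" "v \<in> hverts X"
proof -
  have "vs \<noteq> []" using assms by (auto simp: hpath_between_def hpath_def)
  then have "u \<in> set vs" "v \<in> set vs" using assms by (auto simp: hpath_between_def)
  then show "u \<in> hverts X" "v \<in> hverts X"
    using assms by (auto simp: hpath_between_def hpath_def)
qed

text \<open>Base case for recursion on the bound. Outside the vertex set there is no path at all,
  not even from a point to itself, hence the membership condition.\<close>

lemma hdist_le_0_iff: "hdist X u v \<le> enat 0 \<longleftrightarrow> u = v \<and> u \<in> hverts X"
proof
  assume "hdist X u v \<le> enat 0"
  then obtain vs where vs: "hpath_between X u vs [] v" by (auto simp: hdist_le_iff)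
  then have "length vs = Suc 0" by (auto simp: hpath_between_def hpath_def)
  then have "u = v" using vs by (auto simp: hpath_between_def length_Suc_conv)
  with hpath_between_verts[OF vs] show "u = v \<and> u \<in> hverts X" by simp
next
  assume "u = v \<and> u \<in> hverts X"
  then have "hpath_between X u [u] [] v" by (auto simp: hpath_between_def hpath_def)
  then show "hdist X u v \<le> enat 0" by (auto simp: hdist_le_iff)
qed

text \<open>Breadth-first recursion. Forwards, the last hyperedge of a path of length exactly
  \<open>Suc k\<close> is cut off; backwards, \<open>hpath_between_extend\<close> takes care of
  repeated vertices and hyperedges.\<close>

lemma hdist_le_Suc_iff:
  "hdist X u v \<le> enat (Suc k) \<longleftrightarrow> hdist X u v \<le> enat k \<or>
     (\<exists>w\<in>hverts X. \<exists>e\<in>hedges X. hdist X u w \<le> enat k \<and> w \<in> e \<and> v \<in> e \<and> v \<in> hverts X)"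
    (is "?L \<longleftrightarrow> ?M \<or> ?R")
proof
  assume ?L
  then obtain vs es where path: "hpath_between X u vs es v" "length es \<le> Suc k"
    by (auto simp: hdist_le_iff)
  show "?M \<or> ?R"
  proof (cases "length es \<le> k")
    case True
    then show ?thesis using path by (auto simp: hdist_le_iff)
  next
    case False
    then have len: "length es = Suc k" "length vs = Suc (Suc k)"
      using path by (auto simp: hpath_between_def hpath_def)
    have "vs ! Suc k = v"
      using path len by (metis diff_Suc_1 hpath_between_def last_conv_nth length_0_conv nat.distinct(1))
    moreover have "vs ! k \<in> es ! k" "vs ! Suc k \<in> es ! k" "es ! k \<in> hedges X"
      using path len by (auto simp: hpath_between_def hpath_def)
    moreover note prefix = hpath_between_take[OF path(1), of k]
    then have "hdist X u (vs ! k) \<le> enat k"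
      using len unfolding hdist_le_iff by fastforce
    moreover have "vs ! k \<in> hverts X" "v \<in> hverts X"
      using prefix len path(1) by (auto dest: hpath_between_verts)
    ultimately show ?thesis by auto
  qed
next
  assume "?M \<or> ?R"
  then show ?L
  proof
    assume ?M
    then show ?L by (auto simp: hdist_le_iff intro: le_SucI)
  next
    assume ?R
    then obtain w e vs es where "w \<in> hverts X" "e \<in> hedges X" "w \<in> e" "v \<in> e" "v \<in> hverts X"
      "hpath_between X u vs es w" and k: "length es \<le> k"
      by (auto simp: hdist_le_iff)
    then obtain vs' es' where "hpath_between X u vs' es' v" "length es' \<le> Suc (length es)"
      using hpath_between_extend[of X u vs es w e v] by blast
    with k show ?L by (auto simp: hdist_le_iff intro: le_trans)
  qed
qed

text \<open>The distance is infinite where no path exists, so a finite diameter already contains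
  connectedness.\<close>

lemma hconnected_if_hdiam_le:
  assumes "hdiam X \<le> enat k"
  shows "hconnected X"
  unfolding hconnected_def
proof (intro ballI)
  fix u v assume "u \<in> hverts X" "v \<in> hverts X"
  then have "hdist X u v \<le> enat k"
    using assms by (auto simp: hdiam_def SUP_le_iff)
  then show "\<exists>vs es. hpath_between X u vs es v" by (auto simp: hdist_le_iff)
qed

lemma hdiam_eqI:
  assumes "\<And>u v. u \<in> hverts X \<Longrightarrow> v \<in> hverts X \<Longrightarrow> hdist X u v \<le> enat (Suc k)"
    and uv: "u \<in> hverts X" "v \<in> hverts X" and far: "\<not> hdist X u v \<le> enat k"
  shows "hdiam X = enat (Suc k)"
proof (rule antisym)
  show "hdiam X \<le> enat (Suc k)" using assms(1) by (auto simp: hdiam_def intro!: SUP_least)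
  have "enat (Suc k) \<le> hdist X u v"
    using far by (metis Suc_ile_eq linorder_not_le)
  also have "\<dots> \<le> hdiam X"
    unfolding hdiam_def by (rule SUP_upper2[OF uv(1) SUP_upper[OF uv(2)]])
  finally show "enat (Suc k) \<le> hdiam X" .
qed

section \<open>Comaximality in an arbitrary group and its hypergraph\<close>

context group
begin

text \<open>Inversion maps \<open>carrier G\<close> onto itself and turns a product
  \<open>h \<otimes> k\<close> into \<open>inv k \<otimes> inv h\<close>, which lies in
  \<open>K <#> H\<close>.\<close>

lemma comaximal_sym:
  assumes "subgroup H G" "subgroup K G" "comaximal G H K"
  shows "comaximal G K H"
proof -
  have "g \<in> K <#> H" if g: "g \<in> carrier G" for g
  proof -
    have "inv g \<in> H <#> K" using assms(3) g by (simp add: comaximal_def)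
    then obtain h k where hk: "h \<in> H" "k \<in> K" "inv g = h \<otimes> k" by (auto simp: set_mult_def)
    moreover have "h \<in> carrier G" "k \<in> carrier G"
      using hk assms(1,2) by (auto dest: subgroup.mem_carrier)
    ultimately have "inv (inv g) = inv k \<otimes> inv h"
      by (simp only: inv_mult_group)
    then have "g = inv k \<otimes> inv h"
      using g by (simp only: inv_inv)
    moreover have "inv h \<in> H" "inv k \<in> K"
      using hk subgroup.m_inv_closed[OF assms(1)] subgroup.m_inv_closed[OF assms(2)] by blast+
    ultimately show ?thesis unfolding set_mult_def by blast
  qed
  then have "carrier G \<subseteq> K <#> H" by (rule subsetI)
  moreover have "K <#> H \<subseteq> carrier G"
    using assms(1,2)[THEN subgroup.subset] by (simp add: set_mult_closed)
  ultimately show ?thesis by (simp add: comaximal_def)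
qed

text \<open>The product set stays inside the proper subgroup \<open>L\<close>. With
  \<open>H = K = L\<close> this is irreflexivity; with \<open>L\<close> the rotation subgroup it
  separates subgroups of rotations.\<close>

lemma not_comaximal_subset:
  assumes "subgroup L G" "L \<noteq> carrier G" "H \<subseteq> L" "K \<subseteq> L"
  shows "\<not> comaximal G H K"
proof
  assume "comaximal G H K"
  moreover have "H <#> K \<subseteq> L"
    using assms(3,4) subgroup.m_closed[OF assms(1)] by (auto simp: set_mult_def)
  ultimately show False
    using assms(1,2) by (auto simp: comaximal_def dest: subgroup.subset)
qed

text \<open>Nontriviality comes for free: a trivial factor would be contained in the other one, and
  the product would then be proper.\<close>

lemma comaximal_vertsI:
  assumes "subgroup H G" "subgroup K G" "comaximal G H K" "H \<noteq> carrier G" "K \<noteq> carrier G"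
  shows "H \<in> comaximal_verts G" "K \<in> comaximal_verts G"
proof -
  have "\<not> H \<subseteq> K" "\<not> K \<subseteq> H"
    using not_comaximal_subset[OF assms(2,5), of H K] not_comaximal_subset[OF assms(1,4), of H K]
      assms(3) by blast+
  then have "H \<noteq> {\<one>}" "K \<noteq> {\<one>}"
    using assms(1,2)[THEN subgroup.one_closed] by blast+
  moreover have "comaximal G K H" using assms(1-3) by (rule comaximal_sym)
  ultimately show "H \<in> comaximal_verts G" "K \<in> comaximal_verts G"
    using assms by (auto simp: comaximal_verts_def nontrivial_proper_subgroups_def)
qed

lemma comaximal_vertsD:
  assumes "H \<in> comaximal_verts G"
  shows "subgroup H G" "H \<noteq> carrier G" "H \<noteq> {\<one>}"
  using assms by (auto simp: comaximal_verts_def nontrivial_proper_subgroups_def)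

lemma hverts_comaximal_hypergraph [simp]: "hverts (comaximal_hypergraph G) = comaximal_verts G"
  by (simp add: comaximal_hypergraph_def)

text \<open>By finiteness the pair \<open>{H, K}\<close> extends to a pairwise comaximal family that
  is maximal under inclusion, and such families are exactly the hyperedges.\<close>

lemma adjacent_comaximal_hypergraph_iff:
  assumes fin: "finite (carrier G)" and HK: "H \<in> comaximal_verts G" "K \<in> comaximal_verts G" "H \<noteq> K"
  shows "(\<exists>E\<in>hedges (comaximal_hypergraph G). H \<in> E \<and> K \<in> E) \<longleftrightarrow> comaximal G H K"
proof
  assume "\<exists>E\<in>hedges (comaximal_hypergraph G). H \<in> E \<and> K \<in> E"
  then show "comaximal G H K"
    using HK by (auto simp: comaximal_hypergraph_def pairwise_def)
next
  assume C: "comaximal G H K"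
  let ?F = "{E. E \<subseteq> comaximal_verts G \<and> pairwise (comaximal G) E}"
  have "comaximal_verts G \<subseteq> Pow (carrier G)"
    using comaximal_vertsD(1) subgroup.subset by blast
  then have "finite (comaximal_verts G)"
    using fin by (meson finite_Pow_iff finite_subset)
  then have "finite (Pow (comaximal_verts G))" by simp
  then have "finite ?F" by (rule rev_finite_subset) blast
  moreover have "comaximal G K H"
    using comaximal_sym[OF _ _ C] HK comaximal_vertsD(1) by blast
  then have "{H, K} \<in> ?F"
    using HK C by (simp add: pairwise_insert)
  ultimately obtain E where E: "E \<in> ?F" "{H, K} \<subseteq> E"
    and max: "\<forall>E'\<in>?F. E \<subseteq> E' \<longrightarrow> E = E'"
    using finite_has_maximal2[of ?F "{H, K}"] by meson
  have "\<not> (\<exists>E'\<subseteq>comaximal_verts G. E \<subset> E' \<and> pairwise (comaximal G) E')"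
    using max by blast
  with E(1) have "E \<in> hedges (comaximal_hypergraph G)"
    by (simp add: comaximal_hypergraph_def)
  with E(2) show "\<exists>E\<in>hedges (comaximal_hypergraph G). H \<in> E \<and> K \<in> E" by blast
qed

text \<open>Eliminates hyperedges: the recursion for the distance now refers to the comaximality
  graph alone.\<close>

lemma hdist_comaximal_le_Suc_iff:
  assumes "finite (carrier G)" "K \<in> comaximal_verts G"
  defines "X \<equiv> comaximal_hypergraph G"
  shows "hdist X H K \<le> enat (Suc k) \<longleftrightarrow>
    hdist X H K \<le> enat k \<or> (\<exists>L\<in>comaximal_verts G. hdist X H L \<le> enat k \<and> comaximal G L K)"
proof -
  have irrefl: "\<not> comaximal G K K"
    using not_comaximal_subset[OF comaximal_vertsD(1,2)[OF assms(2)]] by simp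
  have verts: "hverts X = comaximal_verts G" by (simp add: X_def)
  have adj: "(\<exists>E\<in>hedges X. L \<in> E \<and> K \<in> E) \<longleftrightarrow> comaximal G L K"
    if "L \<in> comaximal_verts G" "L \<noteq> K" for L
    unfolding X_def by (rule adjacent_comaximal_hypergraph_iff[OF assms(1) that(1) assms(2) that(2)])
  \<comment> \<open>Only \<open>L = K\<close> could break the equivalence, since \<open>L\<close>
    and \<open>K\<close> then share a hyperedge without being comaximal. Assuming that
    \<open>K\<close> is not yet within distance \<open>k\<close> excludes this case.\<close>
  have "(\<exists>L\<in>hverts X. \<exists>E\<in>hedges X. hdist X H L \<le> enat k \<and> L \<in> E \<and> K \<in> E \<and> K \<in> hverts X) \<longleftrightarrow>
      (\<exists>L\<in>comaximal_verts G. hdist X H L \<le> enat k \<and> comaximal G L K)"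
    if "\<not> hdist X H K \<le> enat k"
  proof (unfold verts, rule bex_cong[OF HOL.refl])
    fix L assume L: "L \<in> comaximal_verts G"
    show "(\<exists>E\<in>hedges X. hdist X H L \<le> enat k \<and> L \<in> E \<and> K \<in> E \<and> K \<in> comaximal_verts G) \<longleftrightarrow>
        hdist X H L \<le> enat k \<and> comaximal G L K"
      using that irrefl adj[OF L] assms(2) by (cases "L = K") auto
  qed
  then show ?thesis unfolding hdist_le_Suc_iff[of X H K k] by argo
qed

text \<open>For \<open>h\<close> in \<open>H\<close> outside \<open>K\<close>, counting shows that
  the group is the disjoint union of \<open>K\<close> and the coset of \<open>h\<close>; both lie in
  \<open>H <#> K\<close>.\<close>

lemma comaximal_if_index_2:
  assumes fin: "finite (carrier G)" and K: "subgroup K G" "order G = 2 * card K"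
    and H: "subgroup H G" "\<not> H \<subseteq> K"
  shows "comaximal G H K"
proof -
  obtain h where h: "h \<in> H" "h \<notin> K" using H by blast
  have hG: "h \<in> carrier G" using h H by (auto dest: subgroup.mem_carrier)
  have KG: "K \<subseteq> carrier G" using K by (auto dest: subgroup.subset)
  \<comment> \<open>Disjointness of the two cosets: \<open>h\<close> is the product of
    \<open>h \<otimes> k\<close> and \<open>inv k\<close>.\<close>
  have "h \<in> K" if "k \<in> K" "h \<otimes> k \<in> K" for k
    using that K(1) hG KG subgroup.m_closed[OF K(1) that(2) subgroup.m_inv_closed[OF K(1) that(1)]]
    by (simp add: m_assoc subset_iff)
  then have disj: "K \<inter> (\<otimes>) h ` K = {}" using h by blast
  have sub: "K \<union> (\<otimes>) h ` K \<subseteq> carrier G" using KG hG by blast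
  have "inj_on ((\<otimes>) h) K" using KG hG by (intro inj_onI) (simp add: subset_iff)
  then have "card ((\<otimes>) h ` K) = card K" by (rule card_image)
  moreover have "finite K" using sub fin by (auto intro: finite_subset)
  ultimately have "card (K \<union> (\<otimes>) h ` K) = card (carrier G)"
    using K(2) disj by (simp add: card_Un_disjoint order_def)
  then have "carrier G = K \<union> (\<otimes>) h ` K"
    using sub fin by (metis card_subset_eq)
  moreover have "K \<subseteq> H <#> K"
  proof
    fix k assume "k \<in> K"
    then have "k = \<one> \<otimes> k" using KG by auto
    then show "k \<in> H <#> K"
      using \<open>k \<in> K\<close> subgroup.one_closed[OF H(1)] unfolding set_mult_def by blast
  qed
  moreover have "(\<otimes>) h ` K \<subseteq> H <#> K" using h by (auto simp: set_mult_def)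
  moreover have "H <#> K \<subseteq> carrier G"
    using KG subgroup.subset[OF H(1)] by (simp add: set_mult_closed)
  ultimately show ?thesis by (auto simp: comaximal_def)
qed

end

section \<open>Elements and basic subgroups of a dihedral group\<close>

text \<open>Conjugation by the involution \<open>b\<close> is a homomorphism sending
  \<open>a\<close> to its inverse, hence every power of \<open>a\<close> to the opposite power. It
  is kept outside the locale \<open>dihedral\<close> because the construction of an instance needs
  it as well.\<close>

lemma (in group) involution_mult_int_pow:
  assumes a_closed: "a \<in> carrier G" and b_closed: "b \<in> carrier G"
    and b_sq: "b \<otimes> b = \<one>" and b_conj: "b \<otimes> a \<otimes> b = inv a"
  shows "b \<otimes> a [^] (i :: int) = a [^] (- i) \<otimes> b"
proof -
  have inv_b: "inv b = b" by (rule inv_equality) (simp_all add: b_sq b_closed)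
  have "(\<lambda>x. b \<otimes> x \<otimes> b) \<in> hom G G"
  proof (rule homI)
    fix x y assume xy: "x \<in> carrier G" "y \<in> carrier G"
    have "b \<otimes> x \<otimes> b \<otimes> (b \<otimes> y \<otimes> b) = b \<otimes> x \<otimes> (b \<otimes> b) \<otimes> (y \<otimes> b)"
      using xy by (simp only: m_assoc m_closed b_closed)
    then show "b \<otimes> (x \<otimes> y) \<otimes> b = b \<otimes> x \<otimes> b \<otimes> (b \<otimes> y \<otimes> b)"
      using xy by (simp add: b_sq m_assoc b_closed)
  qed (simp add: b_closed)
  from hom_int_pow[OF this a_closed _ group_axioms, of i]
  have "b \<otimes> a [^] i \<otimes> b = a [^] (- i)"
    using is_group by (simp add: a_closed b_conj int_pow_neg int_pow_inv)
  then have "b \<otimes> a [^] i \<otimes> b \<otimes> b = a [^] (- i) \<otimes> b" by simp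
  then show ?thesis by (simp add: m_assoc b_sq a_closed b_closed)
qed

text \<open>Separates the subgroup arguments from words and congruences. Only existence of normal
  forms is assumed; their uniqueness will follow from the order. Integer exponents make inverses and
  Bezout identities direct.\<close>

locale dihedral = group G for G (structure) +
  fixes n :: nat and a b
  assumes n_ge: "n \<ge> 2" and order_G: "order G = 2 * n"
    and a_closed [simp]: "a \<in> carrier G" and b_closed [simp]: "b \<in> carrier G"
    and a_pow_n: "a [^] n = \<one>" and b_sq: "b \<otimes> b = \<one>" and b_conj: "b \<otimes> a \<otimes> b = inv a"
    and elems: "x \<in> carrier G \<Longrightarrow> \<exists>i :: int. x = a [^] i \<or> x = a [^] i \<otimes> b"
begin

definition rot :: "'a set" where
  "rot = range (\<lambda>i :: int. a [^] i)"

text \<open>The subgroup generated by \<open>a^q\<close> and \<open>b\<close>, listed as rotations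
  and reflections.\<close>

definition refl_sub :: "nat \<Rightarrow> 'a set" where
  "refl_sub q = range (\<lambda>y. a [^] (int q * y)) \<union> range (\<lambda>y. a [^] (int q * y) \<otimes> b)"

lemma finite_carrier [simp]: "finite (carrier G)"
  using order_G n_ge by (intro card_ge_0_finite) (simp add: order_def)

lemma pow_mod: "a [^] (i mod int n) = a [^] (i :: int)"
proof -
  have "a [^] i = a [^] (int n * (i div int n)) \<otimes> a [^] (i mod int n)"
    by (simp flip: int_pow_mult)
  also have "a [^] (int n * (i div int n)) = \<one>"
    by (simp add: a_pow_n int_pow_int flip: int_pow_pow)
  finally show ?thesis by simp
qed

text \<open>All \<open>2 * n\<close> elements are values of this map on at most \<open>2 * n\<close>
  pairs. So the map is injective and the set of pairs has full size, which forces \<open>b\<close>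
  and \<open>\<one>\<close> to differ.\<close>

lemma normal_form_inj: "inj_on (\<lambda>(i, c). a [^] i \<otimes> c) ({0..<int n} \<times> {\<one>, b})"
  and b_neq_one: "b \<noteq> \<one>"
proof -
  let ?nf = "\<lambda>(i :: int, c). a [^] i \<otimes> c"
  let ?D = "{0..<int n} \<times> {\<one>, b}"
  have "carrier G \<subseteq> ?nf ` ?D"
  proof
    fix x assume "x \<in> carrier G"
    then obtain i :: int where "x = a [^] i \<or> x = a [^] i \<otimes> b" using elems by blast
    then have "x = ?nf (i mod int n, \<one>) \<or> x = ?nf (i mod int n, b)" by (simp add: pow_mod)
    moreover have "i mod int n \<in> {0..<int n}" using n_ge by simp
    ultimately show "x \<in> ?nf ` ?D" by blast
  qed
  moreover have D: "finite ?D" "card ?D = n * card {\<one>, b}" by (simp_all add: card_cartesian_product)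
  ultimately have "2 * n \<le> card (?nf ` ?D)"
    using order_G card_mono[of "?nf ` ?D" "carrier G"] by (simp add: order_def)
  moreover have "card (?nf ` ?D) \<le> card ?D" using D(1) by (rule card_image_le)
  moreover have "n * card {\<one>, b} \<le> n * 2"
    by (intro mult_le_mono2) (simp add: card_insert_if)
  ultimately have *: "card (?nf ` ?D) = card ?D" "2 * n \<le> n * card {\<one>, b}"
    using D(2) by linarith+
  show "inj_on ?nf ?D" using D(1) *(1) by (rule eq_card_imp_inj_on)
  show "b \<noteq> \<one>" using *(2) n_ge by auto
qed

text \<open>The order of \<open>a\<close> is exactly \<open>n\<close>, by uniqueness of normal forms
  after reducing the exponents modulo \<open>n\<close>.\<close>

lemma pow_eq_iff: "a [^] (i :: int) = a [^] (j :: int) \<longleftrightarrow> int n dvd i - j"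
proof
  assume "a [^] i = a [^] j"
  then have "a [^] (i mod int n) = a [^] (j mod int n)" by (simp add: pow_mod)
  then have "(i mod int n, \<one>) = (j mod int n, \<one>)"
    using n_ge by (intro inj_onD[OF normal_form_inj]) simp_all
  then show "int n dvd i - j" by (simp add: mod_eq_dvd_iff)
next
  assume "int n dvd i - j"
  then have "i mod int n = j mod int n" by (simp add: mod_eq_dvd_iff)
  then show "a [^] i = a [^] j" by (metis pow_mod)
qed

lemma b_notin_rot: "b \<notin> rot"
proof
  assume "b \<in> rot"
  then obtain i :: int where "b = a [^] i" by (auto simp: rot_def)
  then have "(0, b) = (i mod int n, \<one>)"
    using n_ge by (intro inj_onD[OF normal_form_inj]) (simp_all add: pow_mod)
  then show False using b_neq_one by simp
qed

lemma pow_b_notin_rot: "a [^] (i :: int) \<otimes> b \<notin> rot"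
proof
  assume "a [^] i \<otimes> b \<in> rot"
  then obtain j :: int where j: "a [^] i \<otimes> b = a [^] j" by (auto simp: rot_def)
  have "b = a [^] (- i) \<otimes> (a [^] i \<otimes> b)"
    by (simp add: int_pow_neg flip: m_assoc)
  also have "\<dots> = a [^] (j - i)" by (simp add: j flip: int_pow_mult)
  finally show False using b_notin_rot by (auto simp: rot_def)
qed

lemmas b_pow = involution_mult_int_pow[OF a_closed b_closed b_sq b_conj]

lemma subgroup_rot: "subgroup rot G"
proof (rule subgroupI)
  fix x y assume "x \<in> rot" "y \<in> rot"
  then obtain i j :: int where "x = a [^] i" "y = a [^] j" by (auto simp: rot_def)
  then have "inv x = a [^] (- i)" "x \<otimes> y = a [^] (i + j)"
    by (simp_all add: int_pow_neg int_pow_mult)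
  then show "inv x \<in> rot" "x \<otimes> y \<in> rot" by (simp_all add: rot_def)
qed (auto simp: rot_def)

lemma rot_neq_carrier: "rot \<noteq> carrier G"
  using b_notin_rot b_closed by metis

lemma card_rot: "order G = 2 * card rot"
proof -
  have "rot = (\<lambda>i :: int. a [^] i) ` {0..<int n}"
  proof -
    have "a [^] i \<in> (\<lambda>i :: int. a [^] i) ` {0..<int n}" for i :: int
      by (rule image_eqI[of _ _ "i mod int n"]) (use n_ge in \<open>simp_all add: pow_mod\<close>)
    then show ?thesis unfolding rot_def by blast
  qed
  moreover have "inj_on (\<lambda>i :: int. a [^] i) {0..<int n}"
  proof (rule inj_onI)
    fix i j :: int assume "i \<in> {0..<int n}" "j \<in> {0..<int n}" "a [^] i = a [^] j"
    then show "i = j" by (simp add: pow_eq_iff flip: mod_eq_dvd_iff)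
  qed
  ultimately show ?thesis by (simp add: order_G card_image)
qed

lemma comaximal_rot:
  assumes "subgroup H G" "\<not> H \<subseteq> rot"
  shows "comaximal G H rot" "comaximal G rot H"
proof -
  show "comaximal G H rot"
    using finite_carrier subgroup_rot card_rot assms by (rule comaximal_if_index_2)
  then show "comaximal G rot H" by (rule comaximal_sym[OF assms(1) subgroup_rot])
qed

lemma subgroup_refl_sub: "subgroup (refl_sub q) G"
proof -
  \<comment> \<open>The multiplication table, with \<open>p\<close> for a power of \<open>a\<close>
    and \<open>f\<close> for a reflection. By \<open>ff\<close>, every reflection is its own
    inverse.\<close>
  have pp: "a [^] i \<otimes> a [^] j = a [^] (i + j)" for i j :: int
    by (simp add: int_pow_mult)
  have pf: "a [^] i \<otimes> (a [^] j \<otimes> b) = a [^] (i + j) \<otimes> b" for i j :: int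
    by (simp add: int_pow_mult m_assoc)
  have fp: "a [^] i \<otimes> b \<otimes> a [^] j = a [^] (i - j) \<otimes> b" for i j :: int
    using pf[of i "- j"] by (simp add: m_assoc b_pow)
  have ff: "a [^] i \<otimes> b \<otimes> (a [^] j \<otimes> b) = a [^] (i - j)" for i j :: int
  proof -
    have "a [^] i \<otimes> b \<otimes> (a [^] j \<otimes> b) = a [^] i \<otimes> b \<otimes> a [^] j \<otimes> b" by (simp add: m_assoc)
    then show ?thesis by (simp add: fp m_assoc b_sq)
  qed
  have invp: "inv (a [^] i) = a [^] (- i)" for i :: int by (simp add: int_pow_neg)
  have invf: "inv (a [^] i \<otimes> b) = a [^] i \<otimes> b" for i :: int
    by (rule inv_equality) (simp_all add: ff)
  show ?thesis
  proof (rule subgroupI)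
    show "refl_sub q \<subseteq> carrier G" "refl_sub q \<noteq> {}" by (auto simp: refl_sub_def)
  next
    fix x assume "x \<in> refl_sub q"
    then consider y where "x = a [^] (int q * y)" | y where "x = a [^] (int q * y) \<otimes> b"
      by (auto simp: refl_sub_def)
    then show "inv x \<in> refl_sub q"
    proof cases
      case (1 y)
      then have "inv x = a [^] (int q * (- y))" by (simp add: invp)
      then show ?thesis unfolding refl_sub_def by blast
    next
      case (2 y)
      then show ?thesis by (auto simp: invf refl_sub_def)
    qed
  next
    fix x y assume "x \<in> refl_sub q" "y \<in> refl_sub q"
    then obtain k l where "x = a [^] (int q * k) \<or> x = a [^] (int q * k) \<otimes> b"
      "y = a [^] (int q * l) \<or> y = a [^] (int q * l) \<otimes> b"
      by (auto simp: refl_sub_def)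
    then have "x \<otimes> y \<in> {a [^] (int q * (k + l)), a [^] (int q * (k + l)) \<otimes> b,
        a [^] (int q * (k - l)), a [^] (int q * (k - l)) \<otimes> b}"
      by (auto simp: pp pf fp ff algebra_simps)
    then show "x \<otimes> y \<in> refl_sub q" unfolding refl_sub_def by blast
  qed
qed

lemma pow_in_refl_sub: "a [^] int q \<in> refl_sub q"
  unfolding refl_sub_def by (rule UnI1, rule range_eqI[of _ _ 1]) simp

lemma refl_sub_not_subset_rot: "\<not> refl_sub q \<subseteq> rot"
proof -
  have "a [^] (int q * 0) \<otimes> b \<in> refl_sub q" unfolding refl_sub_def by blast
  then show ?thesis using b_notin_rot by auto
qed

text \<open>The element \<open>a\<close> is missing: it is no reflection, and
  \<open>a = a^(q y)\<close> would give \<open>n dvd 1 - q y\<close>, hence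
  \<open>q dvd 1\<close>.\<close>

lemma refl_sub_neq_carrier:
  assumes "q dvd n" "q \<noteq> 1"
  shows "refl_sub q \<noteq> carrier G"
proof
  assume "refl_sub q = carrier G"
  then have "a [^] (1 :: int) \<in> refl_sub q" by simp
  then obtain y where "a [^] (1 :: int) = a [^] (int q * y) \<or> a [^] (1 :: int) = a [^] (int q * y) \<otimes> b"
    unfolding refl_sub_def by blast
  moreover have "a [^] (1 :: int) \<noteq> a [^] (int q * y) \<otimes> b"
    using pow_b_notin_rot[of "int q * y"] unfolding rot_def by (metis rangeI)
  ultimately have "int n dvd 1 - int q * y" by (simp add: pow_eq_iff del: int_pow_1)
  then have "int q dvd 1 - int q * y" using assms(1) by (meson dvd_trans int_dvd_int_iff)
  then have "int q dvd 1" by (simp add: dvd_diff_left_iff)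
  with assms(2) show False by simp
qed

section \<open>Comaximality read off from the exponents of rotations\<close>

text \<open>From \<open>u k + v q = 1\<close> each \<open>a^m\<close> splits into a power of
  \<open>a^k\<close> in \<open>H\<close> and a power of \<open>a^q\<close> in
  \<open>refl_sub q\<close>; a trailing \<open>b\<close> is absorbed by the second factor.\<close>

lemma comaximal_refl_sub:
  assumes H: "subgroup H G" "a [^] (k :: int) \<in> H" and "coprime k (int q)"
  shows "comaximal G H (refl_sub q)"
proof -
  obtain u v where uv: "u * k + v * int q = 1"
    using bezout_int[of k "int q"] assms(3) by auto
  have "g \<in> H <#> refl_sub q" if "g \<in> carrier G" for g
  proof -
    from elems[OF that] obtain m :: int where m: "g = a [^] m \<or> g = a [^] m \<otimes> b" by blast
    have "m = (u * k + v * int q) * m" by (simp add: uv)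
    then have "m = k * (u * m) + int q * (v * m)" by (simp add: algebra_simps)
    then have "a [^] m = a [^] (k * (u * m)) \<otimes> a [^] (int q * (v * m))"
      by (metis int_pow_mult a_closed)
    then have "g = a [^] (k * (u * m)) \<otimes> a [^] (int q * (v * m)) \<or>
        g = a [^] (k * (u * m)) \<otimes> (a [^] (int q * (v * m)) \<otimes> b)"
      using m by (auto simp: m_assoc)
    moreover have "a [^] (k * (u * m)) \<in> H"
      using subgroup_int_pow_closed[OF H, of "u * m"] by (simp add: int_pow_pow)
    moreover have "a [^] (int q * (v * m)) \<in> refl_sub q" "a [^] (int q * (v * m)) \<otimes> b \<in> refl_sub q"
      by (auto simp: refl_sub_def)
    ultimately show ?thesis unfolding set_mult_def by blast
  qed
  moreover have "H <#> refl_sub q \<subseteq> carrier G"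
    using H(1) subgroup_refl_sub[THEN subgroup.subset] by (simp add: set_mult_closed subgroup.subset)
  ultimately show ?thesis unfolding comaximal_def by blast
qed

text \<open>The exponents of the rotations in \<open>K\<close> form an ideal of the integers containing \<open>n\<close>.\<close>

lemma prime_dvd_exponents:
  assumes K: "subgroup K G" "K \<noteq> carrier G" "\<not> K \<subseteq> rot"
  obtains q where "prime q" "q dvd n" "\<And>y :: int. a [^] y \<in> K \<Longrightarrow> int q dvd y"
proof -
  let ?P = "\<lambda>d. d > 0 \<and> a [^] int d \<in> K"
  define d where "d = Least ?P"
  have n_in: "a [^] int n \<in> K"
    using K(1) by (simp add: int_pow_int a_pow_n subgroup.one_closed)
  then have d: "d > 0" "a [^] int d \<in> K"
    using LeastI[of ?P n] n_ge by (simp_all add: d_def)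
  have dvd: "int d dvd y" if y: "a [^] y \<in> K" for y :: int
  proof -
    have "a [^] (y mod int d) = a [^] (y + int d * (- (y div int d)))"
      by (simp flip: minus_mult_div_eq_mod)
    also have "\<dots> = a [^] y \<otimes> (a [^] int d) [^] (- (y div int d))"
      by (simp only: int_pow_mult int_pow_pow a_closed)
    also have "\<dots> \<in> K"
      by (rule subgroup.m_closed[OF K(1) y subgroup_int_pow_closed[OF K(1) d(2)]])
    finally have "a [^] int (nat (y mod int d)) \<in> K" using d(1) by simp
    then have "\<not> nat (y mod int d) > 0"
      using not_less_Least[of "nat (y mod int d)" ?P] d(1) by (auto simp: d_def[symmetric] nat_less_iff)
    moreover have "y mod int d \<ge> 0" using d(1) by simp
    ultimately show ?thesis by (simp add: dvd_eq_mod_eq_0)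
  qed
  \<comment> \<open>If \<open>d = 1\<close>, then \<open>K\<close> contains all rotations, so
    \<open>K <#> rot\<close> stays in \<open>K\<close>; yet \<open>K\<close> has a reflection and is
    comaximal with \<open>rot\<close>. The required \<open>q\<close> is then any prime factor of
    \<open>d\<close>.\<close>
  have "d \<noteq> 1"
  proof
    assume "d = 1"
    then have "a \<in> K" using d(2) by simp
    then have "rot \<subseteq> K" using subgroup_int_pow_closed[OF K(1)] by (auto simp: rot_def)
    then show False
      using not_comaximal_subset[OF K(1,2) subset_refl] comaximal_rot(1)[OF K(1,3)] by blast
  qed
  then obtain q where q: "prime q" "q dvd d" using prime_factor_nat by blast
  have "int d dvd int n" using dvd n_in by blast
  then have "q dvd n" using q(2) by (meson dvd_trans int_dvd_int_iff)
  moreover have "int q dvd y" if "a [^] y \<in> K" for y :: int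
    using dvd[OF that] q(2) by (meson dvd_trans int_dvd_int_iff)
  ultimately show ?thesis using that q(1) by blast
qed

text \<open>Factor \<open>a = h \<otimes> k\<close> with \<open>h = a^x\<close>. Then
  \<open>k = a^(1 - x)\<close> lies in \<open>K\<close>, so \<open>q\<close> divides
  \<open>1 - x\<close> and cannot divide \<open>x\<close>.\<close>

lemma comaximal_exponent:
  assumes "H \<subseteq> rot" "subgroup K G" "comaximal G H K" "prime q"
    and K: "\<And>y :: int. a [^] y \<in> K \<Longrightarrow> int q dvd y"
  obtains x :: int where "a [^] x \<in> H" "\<not> int q dvd x"
proof -
  have "a \<in> H <#> K" using assms(3) by (simp add: comaximal_def)
  then obtain h k where hk: "h \<in> H" "k \<in> K" "a = h \<otimes> k" by (auto simp: set_mult_def)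
  obtain x :: int where x: "h = a [^] x" using hk(1) assms(1) by (auto simp: rot_def)
  have "k \<in> carrier G" using subgroup.mem_carrier[OF assms(2) hk(2)] .
  then have "k = inv (a [^] x) \<otimes> (a [^] x \<otimes> k)" by (simp flip: m_assoc)
  also have "\<dots> = inv (a [^] x) \<otimes> a" using hk(3) x by simp
  also have "\<dots> = a [^] (- x) \<otimes> a [^] (1 :: int)" by (simp add: int_pow_neg)
  also have "\<dots> = a [^] (1 - x)" by (simp flip: int_pow_mult del: int_pow_1)
  finally have "int q dvd 1 - x" using K hk(2) by simp
  moreover have "\<not> int q dvd 1" using assms(4) by (auto dest: prime_gt_1_nat)
  ultimately have "\<not> int q dvd x" using dvd_add[of "int q" "1 - x" x] by auto
  with that x hk(1) show ?thesis by blast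
qed

text \<open>\<open>rot\<close> and \<open>refl_sub q\<close> are comaximal, so each witnesses that
  the other is a vertex.\<close>

lemma rot_vertex: "rot \<in> comaximal_verts G"
  and refl_sub_vertex: "prime q \<Longrightarrow> q dvd n \<Longrightarrow> refl_sub q \<in> comaximal_verts G"
proof -
  have *: "rot \<in> comaximal_verts G \<and> refl_sub q \<in> comaximal_verts G" if "prime q" "q dvd n" for q
    using comaximal_vertsI[OF subgroup_refl_sub subgroup_rot
        comaximal_rot(1)[OF subgroup_refl_sub refl_sub_not_subset_rot] _ rot_neq_carrier, of q]
      refl_sub_neq_carrier[of q] that prime_gt_1_nat[of q] by auto
  show "prime q \<Longrightarrow> q dvd n \<Longrightarrow> refl_sub q \<in> comaximal_verts G" using * by blast
  have "n \<noteq> 1" using n_ge by simp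
  then obtain p where "prime p" "p dvd n" using prime_factor_nat by blast
  then show "rot \<in> comaximal_verts G" using * by blast
qed

text \<open>By symmetry the witness in the definition of a vertex is a vertex itself.\<close>

lemma comaximal_neighbourE:
  assumes "H \<in> comaximal_verts G"
  obtains K where "K \<in> comaximal_verts G" "comaximal G H K"
proof -
  obtain K where K: "K \<in> nontrivial_proper_subgroups G" "comaximal G H K"
    using assms by (auto simp: comaximal_verts_def)
  then have "subgroup K G" "K \<noteq> carrier G" by (auto simp: nontrivial_proper_subgroups_def)
  then have "K \<in> comaximal_verts G"
    using comaximal_vertsI(2)[OF comaximal_vertsD(1)[OF assms] _ K(2) comaximal_vertsD(2)[OF assms]]
    by blast
  with K(2) that show ?thesis by blast
qed

text \<open>The prime depends on \<open>K\<close> only and serves all its rotation neighbours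
  \<open>H\<close> simultaneously. This uniformity is what later rules out a common
  neighbour.\<close>

lemma neighbour_exponents:
  assumes K: "K \<in> comaximal_verts G" "\<not> K \<subseteq> rot"
  obtains q where "prime q" "q dvd n"
    "\<And>H. H \<subseteq> rot \<Longrightarrow> comaximal G H K \<Longrightarrow> \<exists>x :: int. a [^] x \<in> H \<and> \<not> int q dvd x"
proof -
  obtain q where q: "prime q" "q dvd n" "\<And>y :: int. a [^] y \<in> K \<Longrightarrow> int q dvd y"
    using prime_dvd_exponents[OF comaximal_vertsD(1,2)[OF K(1)] K(2)] by blast
  have "\<exists>x :: int. a [^] x \<in> H \<and> \<not> int q dvd x" if "H \<subseteq> rot" "comaximal G H K" for H
    using comaximal_exponent[OF that(1) comaximal_vertsD(1)[OF K(1)] that(2) q(1,3)] by blast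
  with that q(1,2) show ?thesis by blast
qed

lemma not_comaximal_rotations:
  assumes "H \<subseteq> rot" "K \<subseteq> rot"
  shows "\<not> comaximal G H K"
  using subgroup_rot rot_neq_carrier assms by (rule not_comaximal_subset)

lemma coprime_prime_int: "prime q \<Longrightarrow> \<not> int q dvd x \<Longrightarrow> coprime x (int q)"
  by (metis coprime_commute prime_imp_coprime prime_nat_int_transfer)

text \<open>Any neighbour of \<open>H\<close> can be traded for a standard one: its prime
  \<open>q\<close> leaves an exponent in \<open>H\<close> coprime to \<open>q\<close>, and Bezout
  makes \<open>refl_sub q\<close> a neighbour.\<close>

lemma rotation_vertex_refl_sub:
  assumes "H \<in> comaximal_verts G" "H \<subseteq> rot"
  obtains q where "prime q" "q dvd n" "comaximal G H (refl_sub q)"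
proof -
  obtain K where K: "K \<in> comaximal_verts G" "comaximal G H K"
    using assms(1) by (rule comaximal_neighbourE)
  then have "\<not> K \<subseteq> rot" using not_comaximal_rotations[OF assms(2)] by blast
  then obtain q where q: "prime q" "q dvd n" and
    "\<And>H. H \<subseteq> rot \<Longrightarrow> comaximal G H K \<Longrightarrow> \<exists>x :: int. a [^] x \<in> H \<and> \<not> int q dvd x"
    using neighbour_exponents[OF K(1)] by blast
  then obtain x :: int where "a [^] x \<in> H" "\<not> int q dvd x" using assms(2) K(2) by blast
  then have "comaximal G H (refl_sub q)"
    using comaximal_refl_sub[OF comaximal_vertsD(1)[OF assms(1)]] coprime_prime_int[OF q(1)] by blast
  with that q show ?thesis by blast
qed

section \<open>Distance bounds in the dihedral case\<close>

abbreviation X where "X \<equiv> comaximal_hypergraph G"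

lemma dist_0_iff: "hdist X H K \<le> enat 0 \<longleftrightarrow> H = K \<and> H \<in> comaximal_verts G"
  by (simp add: hdist_le_0_iff)

lemma dist_mono: "hdist X H K \<le> enat k \<Longrightarrow> k \<le> l \<Longrightarrow> hdist X H K \<le> enat l"
  by (meson enat_ord_simps(1) order_trans)

lemma dist_step:
  assumes "hdist X H L \<le> enat k" "L \<in> comaximal_verts G" "comaximal G L K" "K \<in> comaximal_verts G"
  shows "hdist X H K \<le> enat (Suc k)"
  using assms hdist_comaximal_le_Suc_iff[OF finite_carrier, of K H k] by blast

lemma dist_1_iff:
  assumes "H \<in> comaximal_verts G" "K \<in> comaximal_verts G"
  shows "hdist X H K \<le> enat 1 \<longleftrightarrow> H = K \<or> comaximal G H K"
  using assms hdist_comaximal_le_Suc_iff[OF finite_carrier, of K H 0] by (auto simp: dist_0_iff)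

lemma dist_2_iff:
  assumes "H \<in> comaximal_verts G" "K \<in> comaximal_verts G"
  shows "hdist X H K \<le> enat 2 \<longleftrightarrow> H = K \<or> comaximal G H K \<or>
    (\<exists>L\<in>comaximal_verts G. comaximal G H L \<and> comaximal G L K)"
proof -
  have "hdist X H K \<le> enat 2 \<longleftrightarrow> hdist X H K \<le> enat 1 \<or>
      (\<exists>L\<in>comaximal_verts G. hdist X H L \<le> enat 1 \<and> comaximal G L K)"
    using hdist_comaximal_le_Suc_iff[OF finite_carrier assms(2), of H 1] by (simp add: numeral_2_eq_2)
  then show ?thesis
    using assms by (auto simp: dist_1_iff simp del: One_nat_def)
qed

text \<open>\<open>rot\<close> is a common neighbour.\<close>

lemma dist_le_2_reflections:
  assumes H: "H \<in> comaximal_verts G" "\<not> H \<subseteq> rot" and K: "K \<in> comaximal_verts G" "\<not> K \<subseteq> rot"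
  shows "hdist X H K \<le> enat 2"
  using comaximal_rot[OF comaximal_vertsD(1)[OF H(1)] H(2)]
    comaximal_rot[OF comaximal_vertsD(1)[OF K(1)] K(2)] rot_vertex
  unfolding dist_2_iff[OF H(1) K(1)] by blast

lemma dist_le_3:
  assumes H: "H \<in> comaximal_verts G" and K: "K \<in> comaximal_verts G"
  shows "hdist X H K \<le> enat 3"
proof -
  have sub: "subgroup H G" "subgroup K G" using H K comaximal_vertsD(1) by blast+
  \<comment> \<open>Being about distance bounds, this also accepts walks that repeat a vertex, such
    as \<open>M = H\<close> when \<open>H = rot\<close>.\<close>
  have three: "hdist X H K \<le> enat 3"
    if "L \<in> comaximal_verts G" "M \<in> comaximal_verts G"
      "comaximal G H L" "comaximal G L M" "comaximal G M K" for L M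
  proof -
    have "hdist X H M \<le> enat 2" using that H by (auto simp: dist_2_iff)
    then show ?thesis using dist_step[of H M 2 K] that K by (simp add: numeral_3_eq_3 numeral_2_eq_2)
  qed
  show ?thesis
  proof (cases "H \<subseteq> rot"; cases "K \<subseteq> rot")
    \<comment> \<open>The walk is \<open>H\<close>, \<open>refl_sub q\<close>,
      \<open>refl_sub p\<close>, \<open>K\<close>. For \<open>p = q\<close> the two middle vertices
      coincide and the distance is at most 2.\<close>
    assume r: "H \<subseteq> rot" "K \<subseteq> rot"
    obtain q where q: "prime q" "q dvd n" "comaximal G H (refl_sub q)"
      using H r(1) by (rule rotation_vertex_refl_sub)
    obtain p where p: "prime p" "p dvd n" "comaximal G K (refl_sub p)"
      using K r(2) by (rule rotation_vertex_refl_sub)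
    have pK: "comaximal G (refl_sub p) K" using comaximal_sym[OF sub(2) subgroup_refl_sub p(3)] .
    have v: "refl_sub q \<in> comaximal_verts G" "refl_sub p \<in> comaximal_verts G" using p q refl_sub_vertex by blast+
    show ?thesis
    proof (cases "p = q")
      case True
      then have "hdist X H K \<le> enat 2"
        using q(3) pK v H K by (auto simp: dist_2_iff)
      then show ?thesis by (rule dist_mono) simp
    next
      case False
      then have "coprime (int q) (int p)" using p(1) q(1) by (simp add: primes_coprime)
      then have "comaximal G (refl_sub q) (refl_sub p)"
        using comaximal_refl_sub[OF subgroup_refl_sub pow_in_refl_sub] by blast
      then show ?thesis using three[OF v q(3) _ pK] by blast
    qed
  next
    \<comment> \<open>The walk is \<open>H\<close>, \<open>refl_sub q\<close>, \<open>rot\<close>,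
      \<open>K\<close>; the next case is its mirror image.\<close>
    assume r: "H \<subseteq> rot" "\<not> K \<subseteq> rot"
    obtain q where q: "prime q" "q dvd n" "comaximal G H (refl_sub q)"
      using H r(1) by (rule rotation_vertex_refl_sub)
    show ?thesis
      using three[OF refl_sub_vertex[OF q(1,2)] rot_vertex q(3)
          comaximal_rot(1)[OF subgroup_refl_sub refl_sub_not_subset_rot] comaximal_rot(2)[OF sub(2) r(2)]] .
  next
    assume r: "\<not> H \<subseteq> rot" "K \<subseteq> rot"
    obtain q where q: "prime q" "q dvd n" "comaximal G K (refl_sub q)"
      using K r(2) by (rule rotation_vertex_refl_sub)
    show ?thesis
      using three[OF rot_vertex refl_sub_vertex[OF q(1,2)] comaximal_rot(1)[OF sub(1) r(1)]
          comaximal_rot(2)[OF subgroup_refl_sub refl_sub_not_subset_rot]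
          comaximal_sym[OF sub(2) subgroup_refl_sub q(3)]] .
  next
    assume "\<not> H \<subseteq> rot" "\<not> K \<subseteq> rot"
    then have "hdist X H K \<le> enat 2" by (rule dist_le_2_reflections[OF H _ K])
    then show ?thesis by (rule dist_mono) simp
  qed
qed

section \<open>The three values of the diameter\<close>

text \<open>In a group of order 4 every vertex has order 2 by Lagrange, hence index 2, so distinct
  vertices are comaximal. The vertices \<open>rot\<close> and \<open>refl_sub 2\<close> show that
  the diameter is not 0.\<close>

lemma hdiam_2:
  assumes "n = 2"
  shows "hdiam X = enat 1"
proof -
  have card2: "card H = 2" if H: "H \<in> comaximal_verts G" for H
  proof -
    note H' = comaximal_vertsD[OF H]
    have fin: "finite H" using H'(1) finite_carrier by (meson finite_subset subgroup.subset)
    have *: "card (rcosets H) * card H = 4" using lagrange[OF H'(1)] order_G assms by simp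
    then have dvd4: "card H dvd 4" by (metis dvd_triv_right)
    then have "card H \<le> 4" by (simp add: dvd_imp_le)
    moreover have "card H \<noteq> 0" by (rule notI) (use dvd4 in simp)
    moreover have "card H \<noteq> 3" by (rule notI) (use dvd4 in simp)
    ultimately have "card H = 1 \<or> card H = 2 \<or> card H = 4" by linarith
    moreover have "card H \<noteq> 1"
      using H'(3) subgroup.one_closed[OF H'(1)] by (auto simp: card_1_singleton_iff)
    moreover have "card H \<noteq> 4"
      using card_subset_eq[OF finite_carrier subgroup.subset[OF H'(1)]] H'(2) order_G assms
      by (auto simp: order_def)
    ultimately show ?thesis by blast
  qed
  have "hdist X H K \<le> enat (Suc 0)" if H: "H \<in> comaximal_verts G" and K: "K \<in> comaximal_verts G" for H K
  proof (cases "H = K")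
    case False
    have "finite K" using card2[OF K] by (simp add: card_ge_0_finite)
    then have "\<not> H \<subseteq> K" using False card_subset_eq[of K H] card2 H K by auto
    moreover have "order G = 2 * card K" using card2[OF K] order_G assms by simp
    ultimately have "comaximal G H K"
      using comaximal_if_index_2[OF finite_carrier] H K comaximal_vertsD(1) by blast
    then show ?thesis using dist_1_iff[OF H K] by simp
  qed (use H dist_1_iff[OF H K] in simp)
  moreover have "prime (2 :: nat)" "2 dvd n" using assms by simp_all
  moreover have "rot \<noteq> refl_sub 2" using refl_sub_not_subset_rot[of 2] by blast
  ultimately have "hdiam X = enat (Suc 0)"
    using rot_vertex refl_sub_vertex[of 2]
    by (intro hdiam_eqI[of X _ rot "refl_sub 2"]) (simp_all add: dist_0_iff del: enat_0_iff)
  then show ?thesis by simp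
qed

text \<open>The pair is proper because the group has at least 4 elements, and \<open>rot\<close> is
  a neighbour.\<close>

lemma comaximal_pair_reflection:
  assumes x: "x \<in> carrier G" "x \<otimes> x = \<one>" "x \<notin> rot"
  shows "subgroup {\<one>, x} G" "{\<one>, x} \<in> comaximal_verts G"
proof -
  have "inv x = x" by (rule inv_equality) (use x in simp_all)
  then show sub: "subgroup {\<one>, x} G" using x by (intro subgroupI) auto
  have "card {\<one>, x} \<le> 2" by (simp add: card_insert_if)
  then have "{\<one>, x} \<noteq> carrier G" using order_G n_ge by (auto simp: order_def)
  moreover have "\<not> {\<one>, x} \<subseteq> rot" using x(3) by simp
  ultimately show "{\<one>, x} \<in> comaximal_verts G"
    using comaximal_vertsI(1)[OF sub subgroup_rot comaximal_rot(1)[OF sub]] rot_neq_carrier by blast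
qed

text \<open>The subgroups generated by the reflections \<open>b\<close> and
  \<open>a \<otimes> b\<close> have a product set of at most 4 elements, fewer than
  \<open>2 * n\<close>.\<close>

lemma exists_dist_ge_2:
  assumes "n > 2"
  obtains H K where "H \<in> comaximal_verts G" "K \<in> comaximal_verts G" "\<not> hdist X H K \<le> enat 1"
proof -
  have ab: "a \<otimes> b \<notin> rot" using pow_b_notin_rot[of 1] by simp
  have "a \<otimes> b \<otimes> (a \<otimes> b) = a \<otimes> (b \<otimes> a \<otimes> b)" by (simp add: m_assoc)
  then have ab2: "a \<otimes> b \<otimes> (a \<otimes> b) = \<one>" by (simp add: b_conj)
  let ?H = "{\<one>, b}" and ?K = "{\<one>, a \<otimes> b}"
  have V: "?H \<in> comaximal_verts G" "?K \<in> comaximal_verts G"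
    using comaximal_pair_reflection[of b] comaximal_pair_reflection[of "a \<otimes> b"] ab ab2 b_sq b_notin_rot
    by simp_all
  have "a \<noteq> \<one>"
    using pow_eq_iff[of 1 0] n_ge by (auto dest: zdvd_imp_le)
  then have "b \<noteq> a \<otimes> b" by (simp only: r_cancel_one' a_closed b_closed not_False_eq_True)
  then have "?H \<noteq> ?K" using b_neq_one by blast
  moreover have "\<not> comaximal G ?H ?K"
  proof
    assume "comaximal G ?H ?K"
    then have "carrier G = {\<one> \<otimes> \<one>, \<one> \<otimes> (a \<otimes> b), b \<otimes> \<one>, b \<otimes> (a \<otimes> b)}"
      by (auto simp: comaximal_def set_mult_def)
    also have "card \<dots> \<le> 4"
      using card_length[of "[\<one> \<otimes> \<one>, \<one> \<otimes> (a \<otimes> b), b \<otimes> \<one>, b \<otimes> (a \<otimes> b)]"]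
      by (simp del: l_one r_one)
    finally show False using order_G assms by (simp add: order_def)
  qed
  ultimately show ?thesis using V that dist_1_iff[OF V] by blast
qed

lemma hdiam_primepow:
  assumes "n > 2" "prime p" "n = p ^ k"
  shows "hdiam X = enat 2"
proof -
  have eq_rot: "H = rot" if H: "H \<in> comaximal_verts G" "H \<subseteq> rot" for H
  proof -
    obtain K where K: "K \<in> comaximal_verts G" "comaximal G H K"
      using H(1) by (rule comaximal_neighbourE)
    then have "\<not> K \<subseteq> rot" using not_comaximal_rotations[OF H(2)] by blast
    then obtain q where q: "prime q" "q dvd n" and
      "\<And>H. H \<subseteq> rot \<Longrightarrow> comaximal G H K \<Longrightarrow> \<exists>x :: int. a [^] x \<in> H \<and> \<not> int q dvd x"
      using neighbour_exponents[OF K(1)] by blast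
    then obtain x :: int where x: "a [^] x \<in> H" "\<not> int q dvd x" using H(2) K(2) by blast
    \<comment> \<open>The only prime available is \<open>p\<close>, so an exponent in
      \<open>H\<close> prime to \<open>q\<close> is invertible modulo \<open>n\<close>; hence
      \<open>a\<close> itself lies in \<open>H\<close>.\<close>
    have "q = p" using q assms(2,3) by (metis prime_dvd_power primes_dvd_imp_eq)
    then have "coprime x (int n)"
      using coprime_prime_int[OF q(1) x(2)] assms(3) by simp
    then obtain u v where "u * x + v * int n = 1" using bezout_int[of x "int n"] by auto
    then have uv: "x * u - 1 = int n * (- v)" by (simp add: algebra_simps)
    have "a [^] (x * u) = a [^] (1 :: int)" unfolding pow_eq_iff uv by simp
    then have "(a [^] x) [^] u = a" by (simp add: int_pow_pow)
    then have "a \<in> H" using subgroup_int_pow_closed[OF comaximal_vertsD(1)[OF H(1)] x(1), of u] by simp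
    then have "rot \<subseteq> H"
      using subgroup_int_pow_closed[OF comaximal_vertsD(1)[OF H(1)]] by (auto simp: rot_def)
    with H(2) show ?thesis by blast
  qed
  have le: "hdist X H K \<le> enat (Suc 1)" if H: "H \<in> comaximal_verts G" and K: "K \<in> comaximal_verts G" for H K
  proof (cases "H \<subseteq> rot \<or> K \<subseteq> rot")
    case True
    then have "H = rot \<or> K = rot" using eq_rot H K by blast
    then have "H = K \<or> comaximal G H K"
      using comaximal_rot[OF comaximal_vertsD(1)[OF H]] comaximal_rot[OF comaximal_vertsD(1)[OF K]]
        eq_rot[OF H] eq_rot[OF K] by blast
    then have "hdist X H K \<le> enat 1" using dist_1_iff[OF H K] by simp
    then show ?thesis by (rule dist_mono) simp
  next
    case False
    then show ?thesis using dist_le_2_reflections[OF H _ K] by (simp add: numeral_2_eq_2)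
  qed
  obtain H K where HK: "H \<in> comaximal_verts G" "K \<in> comaximal_verts G" "\<not> hdist X H K \<le> enat 1"
    using exists_dist_ge_2[OF assms(1)] .
  have "hdiam X = enat (Suc 1)"
    using hdiam_eqI[of X 1 H K, unfolded hverts_comaximal_hypergraph] le HK by blast
  then show ?thesis by (simp add: numeral_2_eq_2)
qed

definition rot_sub :: "nat \<Rightarrow> 'a set" where
  "rot_sub d = range (\<lambda>y. a [^] (int d * y))"

lemma subgroup_rot_sub: "subgroup (rot_sub d) G"
proof (rule subgroupI)
  fix x y assume "x \<in> rot_sub d" "y \<in> rot_sub d"
  then obtain i j where ij: "x = a [^] (int d * i)" "y = a [^] (int d * j)" by (auto simp: rot_sub_def)
  have "inv x = a [^] (int d * (- i))" by (simp add: ij int_pow_neg)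
  moreover have "x \<otimes> y = a [^] (int d * (i + j))" by (simp add: ij int_pow_mult distrib_left)
  ultimately show "inv x \<in> rot_sub d" "x \<otimes> y \<in> rot_sub d" unfolding rot_sub_def by blast+
qed (auto simp: rot_sub_def)

lemma rot_sub_subset_rot: "rot_sub d \<subseteq> rot"
  by (auto simp: rot_sub_def rot_def)

text \<open>Exponents are determined modulo \<open>n\<close> only, so divisibility by
  \<open>d\<close> is a property of the rotation because \<open>d\<close> divides
  \<open>n\<close>.\<close>

lemma pow_in_rot_sub_iff:
  assumes "d dvd n"
  shows "a [^] (x :: int) \<in> rot_sub d \<longleftrightarrow> int d dvd x"
proof
  assume "a [^] x \<in> rot_sub d"
  then obtain y where "a [^] x = a [^] (int d * y)" by (auto simp: rot_sub_def)
  then have "int n dvd x - int d * y" by (simp add: pow_eq_iff)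
  then have "int d dvd x - int d * y" using assms by (meson dvd_trans int_dvd_int_iff)
  then show "int d dvd x" by (simp add: dvd_diff_left_iff)
next
  assume "int d dvd x"
  then show "a [^] x \<in> rot_sub d" by (auto simp: rot_sub_def dvd_def)
qed

text \<open>The neighbour is \<open>refl_sub q\<close>, as the exponent \<open>d\<close> is coprime
  to \<open>q\<close>.\<close>

lemma rot_sub_vertex:
  assumes "prime q" "q dvd n" "\<not> q dvd d"
  shows "rot_sub d \<in> comaximal_verts G"
proof -
  have "a [^] int d \<in> rot_sub d" by (simp add: rot_sub_def image_iff) (metis mult.right_neutral)
  moreover have "coprime (int d) (int q)"
    using assms coprime_prime_int[of q "int d"] by simp
  ultimately have "comaximal G (rot_sub d) (refl_sub q)" by (rule comaximal_refl_sub[OF subgroup_rot_sub])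
  moreover have "rot_sub d \<noteq> carrier G" using rot_sub_subset_rot b_notin_rot b_closed by blast
  moreover have "refl_sub q \<noteq> carrier G" using assms refl_sub_neq_carrier by auto
  ultimately show ?thesis
    using comaximal_vertsI(1)[OF subgroup_rot_sub subgroup_refl_sub] by blast
qed

lemma hdiam_not_primepow:
  assumes "\<And>p k. prime p \<Longrightarrow> k \<ge> 1 \<Longrightarrow> n \<noteq> p ^ k"
  shows "hdiam X = enat 3"
proof -
  obtain p where p: "prime p" "p dvd n" using n_ge prime_factor_nat[of n] by auto
  define k where "k = multiplicity p n"
  have "n \<noteq> 0" "\<not> is_unit p" using n_ge p(1) not_prime_unit by auto
  then obtain m where m: "n = p ^ k * m" "\<not> p dvd m"
    unfolding k_def by (rule multiplicity_decompose')
  have "k \<noteq> 0" using m p(2) by (metis mult_1 power_0)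
  \<comment> \<open>Here it enters that \<open>n\<close> is no prime power. The prime
    \<open>q\<close> from \<open>m\<close> then makes \<open>?H\<close> a vertex, while
    \<open>p\<close> does so for \<open>?K\<close>.\<close>
  then have "m \<noteq> 1" using assms[OF p(1), of k] m(1) by auto
  then obtain q where q: "prime q" "q dvd m" using prime_factor_nat by blast
  have "\<not> q dvd p ^ k"
    using p(1) q m(2) by (metis prime_dvd_power primes_dvd_imp_eq)
  let ?H = "rot_sub (p ^ k)" and ?K = "rot_sub m"
  have V: "?H \<in> comaximal_verts G" "?K \<in> comaximal_verts G"
    using rot_sub_vertex[of q "p ^ k"] rot_sub_vertex[of p m] p q m \<open>\<not> q dvd p ^ k\<close> by simp_all
  have dvd: "p ^ k dvd n" "m dvd n" using m(1) by simp_all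
  have nc: "\<not> comaximal G ?H ?K"
    using rot_sub_subset_rot rot_sub_subset_rot by (rule not_comaximal_rotations)
  have "a [^] int m \<notin> ?H"
  proof
    assume "a [^] int m \<in> ?H"
    then have "p ^ k dvd m" using pow_in_rot_sub_iff[OF dvd(1)] by (simp only: int_dvd_int_iff)
    then show False using m(2) \<open>k \<noteq> 0\<close> by (meson dvd_power dvd_trans neq0_conv)
  qed
  moreover have "a [^] int m \<in> ?K" using pow_in_rot_sub_iff[OF dvd(2), of "int m"] by simp
  ultimately have "?H \<noteq> ?K" by blast
  \<comment> \<open>A common neighbour \<open>L\<close> would supply one prime \<open>r\<close>
    dividing \<open>n = p^k m\<close> but neither \<open>p^k\<close> nor \<open>m\<close>, because
    \<open>?H\<close> and \<open>?K\<close> each contain a rotation whose exponent \<open>r\<close>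
    does not divide.\<close>
  moreover have "False" if L: "L \<in> comaximal_verts G" "comaximal G ?H L" "comaximal G L ?K" for L
  proof -
    have KL: "comaximal G ?K L"
      using comaximal_sym[OF comaximal_vertsD(1)[OF L(1)] subgroup_rot_sub L(3)] .
    have "\<not> L \<subseteq> rot" using not_comaximal_rotations[OF rot_sub_subset_rot] L(2) by blast
    then obtain r where r: "prime r" "r dvd n" and
      ex: "\<And>H. H \<subseteq> rot \<Longrightarrow> comaximal G H L \<Longrightarrow> \<exists>x :: int. a [^] x \<in> H \<and> \<not> int r dvd x"
      using neighbour_exponents[OF L(1)] by blast
    obtain x y :: int where "a [^] x \<in> ?H" "\<not> int r dvd x" "a [^] y \<in> ?K" "\<not> int r dvd y"
      using ex[OF rot_sub_subset_rot L(2)] ex[OF rot_sub_subset_rot KL] by blast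
    then have "\<not> r dvd p ^ k" "\<not> r dvd m"
      unfolding pow_in_rot_sub_iff[OF dvd(1)] pow_in_rot_sub_iff[OF dvd(2)]
      by (meson dvd_trans int_dvd_int_iff)+
    then show False using r m(1) by (simp add: prime_dvd_mult_iff)
  qed
  ultimately have "\<not> hdist X ?H ?K \<le> enat 2"
    unfolding dist_2_iff[OF V] using nc by blast
  moreover have three: "Suc 2 = 3" by simp
  ultimately have "hdiam X = enat (Suc 2)"
    using hdiam_eqI[of X 2 ?H ?K, unfolded hverts_comaximal_hypergraph three] V dist_le_3 three
    by metis
  then show ?thesis by simp
qed

end

section \<open>The presented group as an instance\<close>

text \<open>The relations are read off from the presentation and the order is known. Normal forms
  exist by induction on words: they include the identity and are preserved by left multiplication
  with each letter.\<close>

lemma dihedral_dihedral_group: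
  assumes "n \<ge> 2"
  defines "R \<equiv> dihedral_relations n"
  shows "dihedral (dihedral_group n) n (word_class R [(Gen_a, True)]) (word_class R [(Gen_b, True)])"
proof -
  define G where "G = dihedral_group n"
  define cl where "cl = word_class R"
  define a where "a = cl [(Gen_a, True)]"
  define b where "b = cl [(Gen_b, True)]"
  interpret group G
    unfolding G_def by (rule group_dihedral_group)
  have carrier_G: "carrier G = range cl"
    by (simp add: G_def cl_def R_def dihedral_group_def carrier_presented_group)
  have one_G: "\<one>\<^bsub>G\<^esub> = cl []"
    by (simp add: G_def cl_def R_def dihedral_group_def one_presented_group)
  have mult_G: "cl u \<otimes>\<^bsub>G\<^esub> cl v = cl (u @ v)" for u v
    by (simp add: G_def cl_def R_def dihedral_group_def mult_presented_group)
  have cl_carrier [simp]: "cl u \<in> carrier G" for u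
    by (simp add: carrier_G)
  have closed: "a \<in> carrier G" "b \<in> carrier G"
    by (simp_all add: a_def b_def)
  have cl_rel: "cl l = cl r" if "(l, r) \<in> R" for l r
    using word_eq.relation[OF that, of "[]" "[]"] by (simp add: cl_def word_class_eq_iff)
  have cl_inv: "cl [(x, False)] = inv\<^bsub>G\<^esub> cl [(x, True)]" for x
  proof (rule inv_equality[symmetric])
    have "cl [(x, False), (x, True)] = cl []"
      using word_eq.cancel[of R "[]" x False "[]"] by (simp add: cl_def word_class_eq_iff)
    then show "cl [(x, False)] \<otimes>\<^bsub>G\<^esub> cl [(x, True)] = \<one>\<^bsub>G\<^esub>"
      by (simp add: mult_G one_G)
  qed simp_all
  have cl_pow: "cl (replicate k (x, True)) = cl [(x, True)] [^]\<^bsub>G\<^esub> k" for k x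
  proof (induction k)
    case (Suc k)
    have "cl (replicate (Suc k) (x, True)) = cl (replicate k (x, True)) \<otimes>\<^bsub>G\<^esub> cl [(x, True)]"
      by (simp add: mult_G replicate_append_same)
    with Suc show ?case by simp
  qed (simp add: one_G)
  have a_n: "a [^]\<^bsub>G\<^esub> n = \<one>\<^bsub>G\<^esub>"
    using cl_rel[of "replicate n (Gen_a, True)" "[]"] by (simp add: R_def a_def one_G flip: cl_pow)
  have b_sq: "b \<otimes>\<^bsub>G\<^esub> b = \<one>\<^bsub>G\<^esub>"
    using cl_rel[of "replicate 2 (Gen_b, True)" "[]"]
    by (simp add: R_def b_def one_G mult_G numeral_2_eq_2)
  have inv_b: "inv\<^bsub>G\<^esub> b = b"
    by (rule inv_equality) (simp_all add: b_sq closed)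
  have "b \<otimes>\<^bsub>G\<^esub> a \<otimes>\<^bsub>G\<^esub> inv\<^bsub>G\<^esub> b = inv\<^bsub>G\<^esub> a"
    using cl_rel[of "[(Gen_b, True), (Gen_a, True), (Gen_b, False)]" "[(Gen_a, False)]"]
    by (simp add: R_def a_def b_def mult_G flip: cl_inv)
  then have b_conj: "b \<otimes>\<^bsub>G\<^esub> a \<otimes>\<^bsub>G\<^esub> b = inv\<^bsub>G\<^esub> a" by (simp only: inv_b)
  note b_pow = involution_mult_int_pow[OF closed b_sq b_conj]
  let ?nf = "\<lambda>x. \<exists>i :: int. x = a [^]\<^bsub>G\<^esub> i \<or> x = a [^]\<^bsub>G\<^esub> i \<otimes>\<^bsub>G\<^esub> b"
  have pow_nf: "?nf (a [^]\<^bsub>G\<^esub> (j :: int) \<otimes>\<^bsub>G\<^esub> x)" if x: "?nf x" for j x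
  proof -
    obtain i :: int where i: "x = a [^]\<^bsub>G\<^esub> i \<or> x = a [^]\<^bsub>G\<^esub> i \<otimes>\<^bsub>G\<^esub> b" using x by blast
    then have "a [^]\<^bsub>G\<^esub> j \<otimes>\<^bsub>G\<^esub> x = a [^]\<^bsub>G\<^esub> (j + i) \<or>
        a [^]\<^bsub>G\<^esub> j \<otimes>\<^bsub>G\<^esub> x = a [^]\<^bsub>G\<^esub> (j + i) \<otimes>\<^bsub>G\<^esub> b"
      using closed by (auto simp: int_pow_mult m_assoc)
    then show ?thesis by blast
  qed
  have b_nf: "?nf (b \<otimes>\<^bsub>G\<^esub> x)" if x: "?nf x" for x
  proof -
    obtain i :: int where i: "x = a [^]\<^bsub>G\<^esub> i \<or> x = a [^]\<^bsub>G\<^esub> i \<otimes>\<^bsub>G\<^esub> b" using x by blast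
    have "b \<otimes>\<^bsub>G\<^esub> (a [^]\<^bsub>G\<^esub> i \<otimes>\<^bsub>G\<^esub> b) = b \<otimes>\<^bsub>G\<^esub> a [^]\<^bsub>G\<^esub> i \<otimes>\<^bsub>G\<^esub> b"
      using closed by (simp add: m_assoc)
    also have "\<dots> = a [^]\<^bsub>G\<^esub> (- i)"
      unfolding b_pow using closed by (simp add: m_assoc b_sq)
    finally show ?thesis using i b_pow by blast
  qed
  have letter_nf: "?nf (cl [z] \<otimes>\<^bsub>G\<^esub> x)" if "?nf x" for z x
  proof -
    obtain g s where z: "z = (g, s)" by force
    show ?thesis
    proof (cases g)
      case Gen_a
      have "inv\<^bsub>G\<^esub> a = a [^]\<^bsub>G\<^esub> (- 1 :: int)" using closed by (simp add: int_pow_neg)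
      \<comment> \<open>The sign of the letter becomes the sign of the exponent; for the other
        generator both letters give \<open>b\<close>, which is its own inverse.\<close>
      then have "cl [z] = a [^]\<^bsub>G\<^esub> (if s then 1 else - 1 :: int)"
        using closed by (simp add: z Gen_a cl_inv flip: a_def)
      then show ?thesis using pow_nf[OF that] by simp
    next
      case Gen_b
      then have "cl [z] = b" by (cases s) (simp_all add: z cl_inv inv_b flip: b_def)
      then show ?thesis using b_nf[OF that] by simp
    qed
  qed
  have nf: "?nf (cl u)" for u
  proof (induction u)
    case Nil
    have "cl [] = a [^]\<^bsub>G\<^esub> (0 :: int)" by (simp add: one_G)
    then show ?case by blast
  next
    case (Cons z u)
    then show ?case using letter_nf[of "cl u" z] by (simp add: mult_G)
  qed
  have "dihedral G n a b"
  proof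
    show "order G = 2 * n" unfolding G_def using assms(1) by (simp add: order_dihedral_group)
    show "?nf x" if "x \<in> carrier G" for x using that nf by (auto simp: carrier_G)
  qed (fact assms(1) closed a_n b_sq b_conj)+
  then show ?thesis by (simp add: G_def a_def b_def cl_def)
qed

theorem theorem2p3:
  fixes n :: nat
  assumes "n \<ge> 2"
  shows "hconnected (comaximal_hypergraph (dihedral_group n)) \<and>
         hdiam (comaximal_hypergraph (dihedral_group n)) \<le> 3 \<and>
         hdiam (comaximal_hypergraph (dihedral_group n)) =
           (if n = 2 then 1
            else if \<exists>p \<alpha>. prime p \<and> \<alpha> \<ge> 1 \<and> n = p ^ \<alpha> then 2
            else 3)"
proof -
  let ?X = "comaximal_hypergraph (dihedral_group n)"
  \<comment> \<open>Once the value is known, the bound 3 and connectedness follow from it. Values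
    are written with \<open>enat\<close> to match the lemmas and converted to numerals at the
    end.\<close>
  have diam: "hdiam ?X = (if n = 2 then enat 1
      else if \<exists>p \<alpha>. prime p \<and> \<alpha> \<ge> 1 \<and> n = p ^ \<alpha> then enat 2 else enat 3)"
  proof -
    consider "n = 2" | p \<alpha> where "n \<noteq> 2" "prime p" "\<alpha> \<ge> 1" "n = p ^ \<alpha>"
      | "n \<noteq> 2" "\<nexists>p \<alpha>. prime p \<and> \<alpha> \<ge> 1 \<and> n = p ^ \<alpha>" by blast
    then show ?thesis
    proof cases
      case 1
      then show ?thesis using dihedral.hdiam_2[OF dihedral_dihedral_group[OF assms]] by simp
    next
      case (2 p \<alpha>)
      then have "hdiam ?X = enat 2"
        using dihedral.hdiam_primepow[OF dihedral_dihedral_group[OF assms], of p \<alpha>] assms by simp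
      with 2 show ?thesis by (metis (full_types))
    next
      case 3
      then have "hdiam ?X = enat 3"
        using dihedral.hdiam_not_primepow[OF dihedral_dihedral_group[OF assms]] by blast
      with 3 show ?thesis by simp
    qed
  qed
  then have le: "hdiam ?X \<le> enat 3" by simp
  then have "hconnected ?X" by (rule hconnected_if_hdiam_le)
  moreover have "hdiam ?X \<le> 3" using le by (simp only: numeral_eq_enat)
  ultimately show ?thesis
    using diam by (simp only: numeral_eq_enat one_enat_def simp_thms)
qed

end
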